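(* Let $\beta\equiv\beta^{(2n)}=\{\beta_i\}_{i\in\mathbb{Z}_+^N,\,|i|\le 2n}$ be an $N$-dimensional real sequence with moment matrix $\mathcal{M}(n)\equiv\mathcal{M}(n)(\beta)$, and let $\mathcal{Q}\equiv\{q_i\}_{i=1}^m\subseteq\mathbb{R}[t_1,\dots,t_N]$ with $\deg q_i=2k_i$ or $2k_i-1$ $(1\le i\le m)$. Let $K_{\mathcal{Q}}:=\{t\in\mathbb{R}^N: q_i(t)\ge 0,\ 1\le i\le m\}$. Then $\beta$ has a $\operatorname{rank}\mathcal{M}(n)$-atomic representing measure supported in $K_{\mathcal{Q}}$ if and only if $\mathcal{M}(n)\ge 0$ and $\mathcal{M}(n)$ admits a flat extension $\mathcal{M}(n+1)$ such that $\mathcal{M}_{q_i}(n+k_i)\ge 0$ $(1\le i\le m)$. In this case, $\mathcal{M}(n+1)$ admits a unique representing measure $\mu$, which is a $\operatorname{rank}\mathcal{M}(n)$-atomic (minimal) representing measure for $\beta$ supported in $K_{\mathcal{Q}}$; moreover, $\mu$ has precisely $\operatorname{rank}\mathcal{M}(n)-\operatorname{rank}\mathcal{M}_{q_i}(n+k_i)$ atoms in $\mathcal{Z}(q_i):=\{t\in\mathbb{R}^N:q_i(t)=0\}$, $1\le i\le m$.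
   Context: For $i=(i_1,\dots,i_N)\in\mathbb{Z}_+^N$, $|i|=i_1+\dots+i_N$ and $t^i=t_1^{i_1}\cdots t_N^{i_N}$. A representing measure for $\beta^{(2n)}$ (equivalently, for $\mathcal{M}(n)(\beta)$) is a positive Borel measure $\mu$ on $\mathbb{R}^N$ with $\beta_i=\int t^i\,d\mu$ (convergent) for all $|i|\le 2n$. It is $r$-atomic if $\mu=\sum_{s=1}^r\rho_s\delta_{x_s}$ with distinct $x_s$ and $\rho_s>0$. Every representing measure satisfies $\operatorname{card}\operatorname{supp}\mu\ge\operatorname{rank}\mathcal{M}(n)$, whence "minimal". The moment matrix $\mathcal{M}(n)(\beta)$ has rows and columns indexed by $\{i\in\mathbb{Z}_+^N:|i|\le n\}$, with entry $\beta_{i+j}$ in row $i$, column $j$. $A\ge 0$ means positive semidefinite. An extension $\mathcal{M}(n+1)$ of $\mathcal{M}(n)(\beta)$ is a moment matrix $\mathcal{M}(n+1)(\tilde\beta)$ where $\tilde\beta=\tilde\beta^{(2n+2)}$ is a real sequence extending $\beta$; it is flat if $\operatorname{rank}\mathcal{M}(n+1)=\operatorname{rank}\mathcal{M}(n)$. If $\mathcal{M}(n)\ge0$ has a flat extension $\mathcal{M}(n+1)$, then $\mathcal{M}(n+1)$ has unique successive flat moment matrix extensions $\mathcal{M}(n+2),\mathcal{M}(n+3),\dots$; denote the resulting full sequence again by $\tilde\beta$. Localizing matrices: let $\Lambda_{\tilde\beta}$ be the linear functional on polynomials with $\Lambda_{\tilde\beta}(t^i)=\tilde\beta_i$. For $q$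 with $\deg q=2k$ or $2k-1$, $\mathcal{M}_q(n+k)$ (relative to $\mathcal{M}(n+k)$) is the matrix of size $\binom{n+N}{N}$ with rows and columns indexed by $\{i\in\mathbb{Z}_+^N:|i|\le n\}$, uniquely determined by $\langle \mathcal{M}_q(n+k)\hat f,\hat g\rangle=\Lambda_{\tilde\beta}(q f\bar g)$ for all complex polynomials $f,g$ in $t$ of degree at most $n$, where $\hat f$ is the coefficient vector of $f$ with respect to the monomials. In the theorem, $\mathcal{M}_{q_i}(n+k_i)$ is computed from the flat extension $\mathcal{M}(n+1)$ and its unique successive flat extensions. *)

theory Defs
  imports
    "HOL-Analysis.Analysis"
    "HOL-Probability.Giry_Monad"
    "HOL-Library.Function_Algebras"
    "HOL-Library.Poly_Mapping"
begin

section \<open>Multi-indices and polynomials in \<open>N = CARD('n)\<close> variables\<close>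

type_synonym 'n mindex = "nat ^ 'n"

definition mdeg :: "'n::finite mindex \<Rightarrow> nat" where
  "mdeg i = (\<Sum>k\<in>UNIV. i $ k)"

definition mindices :: "nat \<Rightarrow> 'n::finite mindex set" where
  "mindices d = {i. mdeg i \<le> d}"

definition monom_val :: "real ^ 'n::finite \<Rightarrow> 'n mindex \<Rightarrow> real" where
  "monom_val t i = (\<Prod>k\<in>UNIV. (t $ k) ^ (i $ k))"

text \<open>
  A polynomial is the finitely supported family of its coefficients, indexed by exponent vectors.
  The ring structure is the one of \<^theory>\<open>HOL-Library.Poly_Mapping\<close>, i.e. multiplication is
  convolution.
\<close>

type_synonym ('n, 'a) mpolynomial = "'n mindex \<Rightarrow>\<^sub>0 'a"

text \<open>The degree of the zero polynomial is \<open>0\<close> here.\<close>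

definition total_degree :: "('n::finite, 'a::zero) mpolynomial \<Rightarrow> nat" where
  "total_degree p = Max (insert 0 (mdeg ` Poly_Mapping.keys p))"

definition poly_val :: "('n::finite, real) mpolynomial \<Rightarrow> real ^ 'n \<Rightarrow> real" where
  "poly_val p t = (\<Sum>a\<in>Poly_Mapping.keys p. Poly_Mapping.lookup p a * monom_val t a)"

definition basic_closed_set :: "nat \<Rightarrow> (nat \<Rightarrow> ('n::finite, real) mpolynomial) \<Rightarrow> (real ^ 'n) set" where
  "basic_closed_set m q = {t. \<forall>i\<in>{1..m}. 0 \<le> poly_val (q i) t}"

definition zero_set :: "('n::finite, real) mpolynomial \<Rightarrow> (real ^ 'n) set" where
  "zero_set p = {t. poly_val p t = 0}"


section \<open>Real square matrices with a finite index set\<close>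

text \<open>
  A matrix with rows and columns indexed by a finite set \<open>I\<close> is a function of two arguments of
  which only the entries on \<open>I \<times> I\<close> matter.  Its rank is the dimension of the column space, a
  subspace of the vector space of real functions (with pointwise operations).
\<close>

definition fun_scale :: "real \<Rightarrow> ('a \<Rightarrow> real) \<Rightarrow> 'a \<Rightarrow> real" where
  "fun_scale c f = (\<lambda>x. c * f x)"

lemma vector_space_fun_scale: "vector_space fun_scale"
  by unfold_locales (auto simp: fun_scale_def fun_eq_iff algebra_simps)

definition mat_rank :: "'a set \<Rightarrow> ('a \<Rightarrow> 'a \<Rightarrow> real) \<Rightarrow> nat" where
  "mat_rank I A = vector_space.dim fun_scale ((\<lambda>j i. if i \<in> I then A i j else 0) ` I)"

definition psd :: "'a set \<Rightarrow> ('a \<Rightarrow> 'a \<Rightarrow> real) \<Rightarrow> bool" where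
  "psd I A \<longleftrightarrow> (\<forall>i\<in>I. \<forall>j\<in>I. A i j = A j i) \<and>
             (\<forall>v. 0 \<le> (\<Sum>i\<in>I. \<Sum>j\<in>I. v i * A i j * v j))"


section \<open>Moment matrices and flat extensions\<close>

text \<open>
  Multisequences are total functions.  A truncated sequence of order \<open>2n\<close> is represented by any
  function with the right values on \<^term>\<open>mindices (2 * n)\<close>; no notion below, when used at
  level \<open>n\<close>, looks at other values.  The moment matrix \<open>M(n)(\<beta>)\<close> is
  \<open>moment_matrix \<beta>\<close> with index set \<open>mindices n\<close>.
\<close>

definition moment_matrix :: "('n::finite mindex \<Rightarrow> real) \<Rightarrow> 'n mindex \<Rightarrow> 'n mindex \<Rightarrow> real" where
  "moment_matrix \<beta> i j = \<beta> (i + j)"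

definition moment_rank :: "nat \<Rightarrow> ('n::finite mindex \<Rightarrow> real) \<Rightarrow> nat" where
  "moment_rank n \<beta> = mat_rank (mindices n) (moment_matrix \<beta>)"

definition moment_psd :: "nat \<Rightarrow> ('n::finite mindex \<Rightarrow> real) \<Rightarrow> bool" where
  "moment_psd n \<beta> \<longleftrightarrow> psd (mindices n) (moment_matrix \<beta>)"

text \<open>\<open>M(n+1)(\<sigma>)\<close> is a flat extension of \<open>M(n)(\<beta>)\<close>.\<close>

definition flat_extension ::
    "nat \<Rightarrow> ('n::finite mindex \<Rightarrow> real) \<Rightarrow> ('n mindex \<Rightarrow> real) \<Rightarrow> bool" where
  "flat_extension n \<beta> \<sigma> \<longleftrightarrow>
     (\<forall>i\<in>mindices (2 * n). \<sigma> i = \<beta> i) \<and> moment_rank (n + 1) \<sigma> = moment_rank n \<beta>"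

text \<open>
  The full sequence obtained from \<open>M(l)(\<sigma>)\<close> by its successive flat extensions
  \<open>M(l+1), M(l+2), \<dots>\<close>.  It is used only for \<open>l = n + 1\<close> where \<open>M(n+1)(\<sigma>)\<close> is a flat
  extension of some \<open>M(n) \<ge> 0\<close>; then it exists and is unique.
\<close>

definition flat_completion ::
    "nat \<Rightarrow> ('n::finite mindex \<Rightarrow> real) \<Rightarrow> 'n mindex \<Rightarrow> real" where
  "flat_completion l \<sigma> =
     (THE \<tau>. (\<forall>i\<in>mindices (2 * l). \<tau> i = \<sigma> i) \<and> (\<forall>m\<ge>l. flat_extension m \<tau> \<tau>))"


section \<open>Localizing matrices\<close>

definition riesz :: "('n::finite mindex \<Rightarrow> real) \<Rightarrow> ('n, complex) mpolynomial \<Rightarrow> complex" where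
  "riesz \<tau> p = (\<Sum>a\<in>Poly_Mapping.keys p. Poly_Mapping.lookup p a * of_real (\<tau> a))"

definition complex_poly :: "('n::finite, real) mpolynomial \<Rightarrow> ('n, complex) mpolynomial" where
  "complex_poly = Poly_Mapping.map of_real"

definition conj_poly :: "('n::finite, complex) mpolynomial \<Rightarrow> ('n, complex) mpolynomial" where
  "conj_poly = Poly_Mapping.map cnj"

text \<open>The \<open>k\<close> with \<open>deg q = 2k\<close> or \<open>deg q = 2k - 1\<close>.\<close>

definition half_degree :: "('n::finite, real) mpolynomial \<Rightarrow> nat" where
  "half_degree q = (total_degree q + 1) div 2"

text \<open>
  \<open>A\<close> is the matrix with index set \<open>mindices d\<close> (and padded by zeros) such that
  \<open>\<langle>A f\<^sup>^, g\<^sup>^\<rangle> = \<Lambda>(q f g\<^sup>-)\<close> for all complex polynomials \<open>f, g\<close> of degree at most \<open>d\<close>, where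
  \<open>f\<^sup>^\<close> is the vector of coefficients of \<open>f\<close>.
\<close>

definition is_localizing_matrix ::
    "('n::finite mindex \<Rightarrow> real) \<Rightarrow> ('n, real) mpolynomial \<Rightarrow> nat
      \<Rightarrow> ('n mindex \<Rightarrow> 'n mindex \<Rightarrow> real) \<Rightarrow> bool" where
  "is_localizing_matrix \<tau> q d A \<longleftrightarrow>
     (\<forall>i j. i \<notin> mindices d \<or> j \<notin> mindices d \<longrightarrow> A i j = 0) \<and>
     (\<forall>f g. total_degree f \<le> d \<longrightarrow> total_degree g \<le> d \<longrightarrow>
        (\<Sum>i\<in>mindices d.
           (\<Sum>j\<in>mindices d. of_real (A i j) * Poly_Mapping.lookup f j) * cnj (Poly_Mapping.lookup g i))
        = riesz \<tau> (complex_poly q * f * conj_poly g))"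

text \<open>
  \<open>M\<^sub>q(l)\<close>, relative to the moment matrix \<open>M(l)(\<tau>)\<close>: if \<open>l = d + k\<close> with \<open>k = half_degree q\<close>, its
  index set is \<open>mindices d\<close>.
\<close>

definition localizing_matrix ::
    "('n::finite mindex \<Rightarrow> real) \<Rightarrow> ('n, real) mpolynomial \<Rightarrow> nat
      \<Rightarrow> 'n mindex \<Rightarrow> 'n mindex \<Rightarrow> real" where
  "localizing_matrix \<tau> q l = (THE A. is_localizing_matrix \<tau> q (l - half_degree q) A)"


section \<open>Representing measures\<close>

definition representing_measure ::
    "nat \<Rightarrow> ('n::finite mindex \<Rightarrow> real) \<Rightarrow> (real ^ 'n) measure \<Rightarrow> bool" where
  "representing_measure n \<beta> \<mu> \<longleftrightarrow> sets \<mu> = sets borel \<and>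
     (\<forall>i\<in>mindices (2 * n). integrable \<mu> (\<lambda>t. monom_val t i) \<and>
        \<beta> i = (\<integral>t. monom_val t i \<partial>\<mu>))"

definition supp_measure :: "'a::topological_space measure \<Rightarrow> 'a set" where
  "supp_measure \<mu> = {x. \<forall>U. open U \<longrightarrow> x \<in> U \<longrightarrow> 0 < emeasure \<mu> U}"

definition atomic_measure :: "nat \<Rightarrow> 'a::topological_space measure \<Rightarrow> bool" where
  "atomic_measure r \<mu> \<longleftrightarrow> sets \<mu> = sets borel \<and>
     (\<exists>X \<rho>. finite X \<and> card X = r \<and> (\<forall>x\<in>X. 0 < \<rho> x) \<and>
        (\<forall>A\<in>sets borel. emeasure \<mu> A = (\<Sum>x\<in>X. ennreal (\<rho> x) * emeasure (return borel x) A)))"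

definition atoms :: "'a measure \<Rightarrow> 'a set" where
  "atoms \<mu> = {x. 0 < emeasure \<mu> {x}}"

definition minimal_representing_measure ::
    "nat \<Rightarrow> ('n::finite mindex \<Rightarrow> real) \<Rightarrow> (real ^ 'n) measure \<Rightarrow> bool" where
  "minimal_representing_measure n \<beta> \<mu> \<longleftrightarrow> representing_measure n \<beta> \<mu> \<and>
     finite (supp_measure \<mu>) \<and>
     (\<forall>\<nu>. representing_measure n \<beta> \<nu> \<longrightarrow> finite (supp_measure \<nu>) \<longrightarrow>
        card (supp_measure \<mu>) \<le> card (supp_measure \<nu>))"


section \<open>The localizing matrix is well defined\<close>

lemma finite_mindices: "finite (mindices d :: 'n::finite mindex set)"
proof -
  have "(mindices d :: 'n mindex set) \<subseteq> vec_lambda ` (Pi UNIV (\<lambda>_. {..d}))"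
  proof
    fix i :: "'n mindex" assume i: "i \<in> mindices d"
    have "i $ k \<le> d" for k
      using i member_le_sum[of k UNIV "\<lambda>k. i $ k"] by (auto simp: mindices_def mdeg_def)
    then have "vec_nth i \<in> Pi UNIV (\<lambda>_. {..d})" by auto
    then show "i \<in> vec_lambda ` (Pi UNIV (\<lambda>_. {..d}))"
      by (metis image_eqI vec_nth_inverse)
  qed
  moreover have "finite (Pi UNIV (\<lambda>_::'n. {..d}))"
    using finite_PiE[of "UNIV :: 'n set" "\<lambda>_. {..d}"] by (simp add: PiE_UNIV_domain)
  ultimately show ?thesis by (meson finite_imageI finite_subset)
qed

lemma total_degree_le_iff:
  "total_degree p \<le> d \<longleftrightarrow> Poly_Mapping.keys p \<subseteq> mindices d"
  by (auto simp: total_degree_def mindices_def)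

lemma riesz_superset:
  assumes "finite S" "Poly_Mapping.keys p \<subseteq> S"
  shows "riesz \<tau> p = (\<Sum>a\<in>S. Poly_Mapping.lookup p a * of_real (\<tau> a))"
  unfolding riesz_def using assms
  by (intro sum.mono_neutral_left) (auto simp: in_keys_iff)

lemma riesz_add: "riesz \<tau> (p + r) = riesz \<tau> p + riesz \<tau> r"
proof -
  let ?S = "Poly_Mapping.keys p \<union> Poly_Mapping.keys r"
  have "Poly_Mapping.keys (p + r) \<subseteq> ?S" by (rule Poly_Mapping.keys_add)
  then show ?thesis
    by (simp add: riesz_superset[of ?S] lookup_add sum.distrib algebra_simps)
qed

lemma riesz_sum: "riesz \<tau> (\<Sum>x\<in>X. p x) = (\<Sum>x\<in>X. riesz \<tau> (p x))"
proof (induction X rule: infinite_finite_induct)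
  case (insert x X) then show ?case by (simp add: riesz_add)
qed (simp_all add: riesz_def)

lemma riesz_single: "riesz \<tau> (Poly_Mapping.single a c) = c * of_real (\<tau> a)"
  by (simp add: riesz_superset[of "{a}"])

lemma poly_mapping_expansion:
  assumes "finite S" "Poly_Mapping.keys p \<subseteq> S"
  shows "p = (\<Sum>a\<in>S. Poly_Mapping.single a (Poly_Mapping.lookup p a))"
proof (rule poly_mapping_eqI)
  fix k
  show "Poly_Mapping.lookup p k =
      Poly_Mapping.lookup (\<Sum>a\<in>S. Poly_Mapping.single a (Poly_Mapping.lookup p a)) k"
    using assms by (auto simp: lookup_sum lookup_single when_def in_keys_iff)
qed

lemma riesz_mult3:
  assumes "finite S" "Poly_Mapping.keys p \<subseteq> S" "finite T" "Poly_Mapping.keys f \<subseteq> T"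
    and "finite U" "Poly_Mapping.keys g \<subseteq> U"
  shows "riesz \<tau> (p * f * g) =
    (\<Sum>i\<in>U. \<Sum>j\<in>T. \<Sum>a\<in>S. Poly_Mapping.lookup p a * Poly_Mapping.lookup f j *
       Poly_Mapping.lookup g i * of_real (\<tau> (a + j + i)))"
proof -
  have "p * f * g =
      (\<Sum>a\<in>S. Poly_Mapping.single a (Poly_Mapping.lookup p a)) *
      (\<Sum>j\<in>T. Poly_Mapping.single j (Poly_Mapping.lookup f j)) *
      (\<Sum>i\<in>U. Poly_Mapping.single i (Poly_Mapping.lookup g i))"
    by (simp only: poly_mapping_expansion[OF assms(1,2), symmetric]
        poly_mapping_expansion[OF assms(3,4), symmetric]
        poly_mapping_expansion[OF assms(5,6), symmetric])
  also have "\<dots> = (\<Sum>i\<in>U. \<Sum>j\<in>T. \<Sum>a\<in>S. Poly_Mapping.single (a + j + i)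
      (Poly_Mapping.lookup p a * Poly_Mapping.lookup f j * Poly_Mapping.lookup g i))"
    by (simp add: sum_distrib_left sum_distrib_right mult_single)
  finally show ?thesis by (simp add: riesz_sum riesz_single)
qed

lemma lookup_complex_poly: "Poly_Mapping.lookup (complex_poly q) a = of_real (Poly_Mapping.lookup q a)"
  by (simp add: complex_poly_def Poly_Mapping.map.rep_eq when_def)

lemma lookup_conj_poly: "Poly_Mapping.lookup (conj_poly g) a = cnj (Poly_Mapping.lookup g a)"
  by (simp add: conj_poly_def Poly_Mapping.map.rep_eq when_def)

definition localizing_entry ::
    "('n::finite mindex \<Rightarrow> real) \<Rightarrow> ('n, real) mpolynomial \<Rightarrow> 'n mindex \<Rightarrow> 'n mindex \<Rightarrow> real" where
  "localizing_entry \<tau> q i j =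
     (\<Sum>a\<in>Poly_Mapping.keys q. Poly_Mapping.lookup q a * \<tau> (a + i + j))"

lemma riesz_localizing:
  fixes f g :: "('n::finite, complex) mpolynomial"
  assumes "total_degree f \<le> d" "total_degree g \<le> d"
  shows "riesz \<tau> (complex_poly q * f * conj_poly g) =
    (\<Sum>i\<in>mindices d. (\<Sum>j\<in>mindices d. of_real (localizing_entry \<tau> q i j) * Poly_Mapping.lookup f j) *
       cnj (Poly_Mapping.lookup g i))"
proof -
  have "Poly_Mapping.keys (complex_poly q) \<subseteq> Poly_Mapping.keys q"
    by (auto simp: in_keys_iff lookup_complex_poly)
  moreover have "Poly_Mapping.keys f \<subseteq> mindices d"
    using assms(1) by (simp add: total_degree_le_iff)
  moreover have "Poly_Mapping.keys (conj_poly g) \<subseteq> mindices d"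
    using assms(2) by (auto simp: total_degree_le_iff in_keys_iff lookup_conj_poly)
  ultimately show ?thesis
    by (subst riesz_mult3[OF _ _ finite_mindices _ finite_mindices])
       (auto simp: finite_mindices lookup_complex_poly lookup_conj_poly localizing_entry_def
          sum_distrib_left sum_distrib_right algebra_simps intro!: sum.cong)
qed

lemma localizing_matrix_unique:
  fixes \<tau> :: "'n::finite mindex \<Rightarrow> real"
  assumes "is_localizing_matrix \<tau> q d A"
  shows "A = (\<lambda>i j. if i \<in> mindices d \<and> j \<in> mindices d then localizing_entry \<tau> q i j else 0)"
proof (intro ext)
  fix i j :: "'n mindex"
  show "A i j = (if i \<in> mindices d \<and> j \<in> mindices d then localizing_entry \<tau> q i j else 0)"
  proof (cases "i \<in> mindices d \<and> j \<in> mindices d")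
    case True
    define f g :: "('n, complex) mpolynomial"
      where "f = Poly_Mapping.single j 1" and "g = Poly_Mapping.single i 1"
    have fg: "total_degree f \<le> d" "total_degree g \<le> d"
      using True by (auto simp: f_def g_def total_degree_le_iff)
    let ?form = "\<lambda>B :: 'n mindex \<Rightarrow> 'n mindex \<Rightarrow> real.
      \<Sum>i'\<in>mindices d. (\<Sum>j'\<in>mindices d. of_real (B i' j') * Poly_Mapping.lookup f j') *
        cnj (Poly_Mapping.lookup g i')"
    have pick: "?form B = of_real (B i j)" for B
    proof -
      have "?form B = (\<Sum>i'\<in>mindices d. if i' = i then complex_of_real (B i' j) else 0)"
      proof (rule sum.cong[OF refl])
        fix i' :: "'n mindex"
        have "(\<Sum>j'\<in>mindices d. complex_of_real (B i' j') * Poly_Mapping.lookup f j') =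
            (\<Sum>j'\<in>mindices d. if j' = j then complex_of_real (B i' j') else 0)"
          by (rule sum.cong) (auto simp: f_def lookup_single when_def)
        also have "\<dots> = complex_of_real (B i' j)"
          using True by (simp add: finite_mindices)
        finally show "(\<Sum>j'\<in>mindices d. complex_of_real (B i' j') * Poly_Mapping.lookup f j') *
            cnj (Poly_Mapping.lookup g i') = (if i' = i then complex_of_real (B i' j) else 0)"
          by (auto simp: g_def lookup_single when_def)
      qed
      also have "\<dots> = complex_of_real (B i j)"
        using True by (simp add: finite_mindices)
      finally show ?thesis .
    qed
    have "?form A = riesz \<tau> (complex_poly q * f * conj_poly g)"
      using assms fg unfolding is_localizing_matrix_def by blast
    also have "\<dots> = ?form (localizing_entry \<tau> q)"
      by (rule riesz_localizing[OF fg])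
    finally have "A i j = localizing_entry \<tau> q i j"
      unfolding pick of_real_eq_iff .
    then show ?thesis using True by simp
  next
    case False
    then show ?thesis using assms by (auto simp: is_localizing_matrix_def)
  qed
qed

lemma localizing_matrix_exists:
  "is_localizing_matrix \<tau> q d
     (\<lambda>i j. if i \<in> mindices d \<and> j \<in> mindices d then localizing_entry \<tau> q i j else 0)"
  by (auto simp: is_localizing_matrix_def riesz_localizing intro!: sum.cong)

lemma localizing_matrix_eq:
  "localizing_matrix \<tau> q l =
     (\<lambda>i j. if i \<in> mindices (l - half_degree q) \<and> j \<in> mindices (l - half_degree q)
            then localizing_entry \<tau> q i j else 0)"
  unfolding localizing_matrix_def
  by (rule the_equality, rule localizing_matrix_exists, rule localizing_matrix_unique)

end

theory Submission
  imports Defs "HOL-Computational_Algebra.Fundamental_Theorem_Algebra"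
begin

text \<open>
  If \<open>M(n+1)\<close> is a flat extension of \<open>M(n) \<ge> 0\<close>, its column space \<open>H\<close>, a space of functions of the
  multi-index, has dimension \<open>r = rank M(n)\<close> and carries the inner product with reproducing kernel
  \<open>M(n+1)\<close>.  Flatness turns the shifts \<open>u \<mapsto> u (\<cdot> + e\<^sub>k)\<close> into commuting symmetric operators on \<open>H\<close>,
  and a common eigenvector with eigenvalues \<open>x\<^sub>k\<close> is a multiple of \<open>i \<mapsto> x\<^sup>i\<close>.  Expanding
  the columns in an orthogonal eigenbasis yields \<open>r\<close> atoms.  Conversely, \<open>r\<close> atoms admit interpolation
  polynomials \<open>p\<^sub>x\<close> of degree at most \<open>n\<close>.  These force every representing measure of \<open>M(n+1)\<close> to
  live on the atoms, hence uniqueness, also of the successive flat extensions (by applying the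
  existence part at each level).  Finally \<open>M\<^sub>q(n+k) = \<Sum>\<^sub>x \<rho>\<^sub>x q(x) v\<^sub>x v\<^sub>x\<^sup>T\<close> with independent vectors
  \<open>v\<^sub>x = (x\<^sup>i)\<^sub>i\<close>, from which positivity and rank are read off.
\<close>

subsection \<open>Commuting symmetric operators\<close>

text \<open>The fundamental theorem of algebra gives a complex root \<open>z\<close>. A non-real
  \<open>z\<close> yields the factor (x - Re z)^2 + (Im z)^2, by division with remainder over the
  reals.\<close>

lemma real_poly_linear_or_quadratic_factor:
  fixes p :: "real poly"
  assumes "degree p > 0"
  obtains a where "[:- a, 1:] dvd p"
  | a b where "b \<noteq> 0" "[:a\<^sup>2 + b\<^sup>2, - 2 * a, 1:] dvd p"
proof -
  let ?c = "map_poly complex_of_real"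
  have "degree (?c p) > 0" using assms by (simp add: degree_map_poly)
  then obtain z where z: "poly (?c p) z = 0"
    using alg_closed_imp_poly_has_root by blast
  show thesis
  proof (cases "Im z = 0")
    case True
    then have "z = of_real (Re z)" by (simp add: complex_eq_iff)
    moreover have "poly (?c p) (of_real x) = of_real (poly p x)" for x
      by (induction p) (simp_all add: map_poly_pCons)
    ultimately have "complex_of_real (poly p (Re z)) = 0"
      using z by metis
    then have "[:- Re z, 1:] dvd p" by (simp add: poly_eq_0_iff_dvd)
    then show thesis by (rule that(1))
  next
    case False
    define s where "s = [:(Re z)\<^sup>2 + (Im z)\<^sup>2, - 2 * Re z, 1:]"
    define r where "r = p mod s"
    have s0: "s \<noteq> 0" and ds: "degree s = 2" by (auto simp: s_def)
    have "p = s * (p div s) + r" by (simp add: r_def)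
    moreover have "?c (u * v + w) = ?c u * ?c v + ?c w" for u v w
      by (rule poly_eqI) (simp add: coeff_map_poly coeff_mult)
    ultimately have "?c p = ?c s * ?c (p div s) + ?c r" by metis
    moreover have "poly (?c s) z = 0"
      by (simp add: s_def complex_eq_iff power2_eq_square map_poly_pCons algebra_simps)
    ultimately have rz: "poly (?c r) z = 0" using z by simp
    \<comment> \<open>A real remainder of degree at most 1 that vanishes at the non-real
      \<open>z\<close> must be zero.\<close>
    have "degree r \<le> 1"
      using degree_mod_less'[of s p] s0 ds unfolding r_def by (cases "p mod s = 0") auto
    then obtain r0 r1 where r: "r = [:r0, r1:]"
      by (metis degree1_coeffs degree_eq_zeroE le_Suc_eq le_zero_eq pCons_0_0 One_nat_def)
    have "r0 + r1 * Re z = 0" "r1 * Im z = 0"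
      using rz by (auto simp: r map_poly_pCons complex_eq_iff mult.commute)
    with False have "r = 0" by (auto simp: r)
    then have "s dvd p" by (simp add: r_def dvd_eq_mod_eq_0)
    then show thesis using that(2)[of "Im z" "Re z"] False by (simp add: s_def)
  qed
qed

text \<open>The vector p(T) w. Scalar multiplication \<open>s\<close> is a parameter, which makes
  operator polynomials available over an abstract vector space.\<close>

definition op_poly :: "('a::zero \<Rightarrow> 'b::ab_group_add \<Rightarrow> 'b) \<Rightarrow> ('b \<Rightarrow> 'b) \<Rightarrow> 'a poly \<Rightarrow> 'b \<Rightarrow> 'b" where
  "op_poly s T p w = (\<Sum>i\<le>degree p. s (coeff p i) ((T ^^ i) w))"

section \<open>Linear relations and polynomials in one operator\<close>

context vector_space
begin

text \<open>The family is indexed, so repetitions count: two equal members already give a relation.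
  The iterates of an operator on one vector may well repeat.\<close>

lemma linear_relation_exists:
  assumes "finite B" "finite I" "card B < card I" "f ` I \<subseteq> span B"
  shows "\<exists>u. (\<exists>i\<in>I. u i \<noteq> 0) \<and> (\<Sum>i\<in>I. scale (u i) (f i)) = 0"
proof (cases "inj_on f I")
  case False
  then obtain i j where ij: "i \<in> I" "j \<in> I" "i \<noteq> j" "f i = f j" by (auto simp: inj_on_def)
  have "(\<Sum>l\<in>I. scale (if l = i then 1 else if l = j then - 1 else 0) (f l))
      = (\<Sum>l\<in>{i, j}. scale (if l = i then 1 else if l = j then - 1 else 0) (f l))"
    using ij assms(2) by (intro sum.mono_neutral_right) auto
  also have "\<dots> = 0" using ij by simp
  finally show ?thesis
    using ij by (intro exI[of _ "\<lambda>l. if l = i then 1 else if l = j then - 1 else 0"]) auto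
next
  case True
  have "dependent (f ` I)"
    using independent_span_bound[OF assms(1) _ assms(4)] assms(3) True by (auto simp: card_image)
  then obtain u where u: "\<exists>v\<in>f ` I. u v \<noteq> 0" "(\<Sum>v\<in>f ` I. scale (u v) v) = 0"
    using dependent_finite[of "f ` I"] assms(2) by auto
  then show ?thesis
    using True by (intro exI[of _ "\<lambda>i. u (f i)"]) (auto simp: sum.reindex)
qed

lemma linear_sum_scale:
  assumes "Vector_Spaces.linear scale scale T"
  shows "T (\<Sum>i\<in>I. scale (c i) (f i)) = (\<Sum>i\<in>I. scale (c i) (T (f i)))"
proof -
  interpret T: Vector_Spaces.linear scale scale T by fact
  show ?thesis by (simp add: T.sum T.scale)
qed

lemma op_poly_bound:
  "degree p \<le> m \<Longrightarrow> op_poly scale T p w = (\<Sum>i\<le>m. scale (coeff p i) ((T ^^ i) w))"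
  unfolding op_poly_def by (rule sum.mono_neutral_left) (auto simp: coeff_eq_0)

lemma op_poly_add: "op_poly scale T (p + r) w = op_poly scale T p w + op_poly scale T r w"
proof -
  let ?m = "max (degree p) (degree r)"
  have "degree (p + r) \<le> ?m" by (rule degree_add_le_max)
  then show ?thesis
    by (simp add: op_poly_bound[of _ ?m] scale_left_distrib sum.distrib)
qed

lemma op_poly_smult: "op_poly scale T (smult c p) w = scale c (op_poly scale T p w)"
  by (simp add: op_poly_bound[of _ "degree p"] scale_sum_right)

lemma op_poly_pCons_0:
  assumes "Vector_Spaces.linear scale scale T"
  shows "op_poly scale T (pCons 0 p) w = T (op_poly scale T p w)"
proof -
  have "op_poly scale T (pCons 0 p) w = (\<Sum>i\<le>Suc (degree p). scale (coeff (pCons 0 p) i) ((T ^^ i) w))"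
    by (rule op_poly_bound) (simp add: degree_pCons_le)
  also have "\<dots> = (\<Sum>i\<le>degree p. scale (coeff p i) (T ((T ^^ i) w)))"
    by (subst sum.atMost_Suc_shift) simp
  finally show ?thesis by (simp add: op_poly_def linear_sum_scale[OF assms])
qed

lemma op_poly_linear_factor:
  assumes "Vector_Spaces.linear scale scale T"
  shows "op_poly scale T ([:- a, 1:] * p) w = T (op_poly scale T p w) - scale a (op_poly scale T p w)"
proof -
  have "[:- a, 1:] * p = smult (- a) p + pCons 0 p" by simp
  then show ?thesis by (simp only: op_poly_add op_poly_smult op_poly_pCons_0[OF assms]) simp
qed

text \<open>The factor is (x - a)^2 + b^2. With \<open>S a\<close> in the role of T - a the result
  has the shape that a definiteness argument can use.\<close>

lemma op_poly_quadratic_factor: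
  assumes T: "Vector_Spaces.linear scale scale T"
  defines "S \<equiv> \<lambda>a v. T v - scale a v"
  shows "op_poly scale T ([:a\<^sup>2 + b\<^sup>2, - 2 * a, 1:] * p) w
    = S a (S a (op_poly scale T p w)) + scale (b\<^sup>2) (op_poly scale T p w)"
proof -
  have "[:a\<^sup>2 + b\<^sup>2, - 2 * a, 1:] = [:- a, 1:] * [:- a, 1:] + [:b\<^sup>2:]"
    by (simp add: power2_eq_square)
  then have "[:a\<^sup>2 + b\<^sup>2, - 2 * a, 1:] * p = [:- a, 1:] * ([:- a, 1:] * p) + smult (b\<^sup>2) p"
    by (simp only: distrib_right mult.assoc) simp
  then show ?thesis
    by (simp only: op_poly_add op_poly_smult op_poly_linear_factor[OF T] S_def)
qed

end

text \<open>\<open>H\<close> may sit inside an infinite-dimensional space, so the inner product laws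
  are required on \<open>H\<close> only; \<open>B\<close> bounds the dimension of
  \<open>H\<close>.\<close>

locale definite_subspace = vector_space scale
  for scale :: "real \<Rightarrow> 'v::ab_group_add \<Rightarrow> 'v" +
  fixes H :: "'v set" and ip :: "'v \<Rightarrow> 'v \<Rightarrow> real" and B :: "'v set"
  assumes subspace_H: "subspace H"
    and finite_B: "finite B" and H_span: "H \<subseteq> span B"
    and ip_add: "\<And>u v w. u \<in> H \<Longrightarrow> v \<in> H \<Longrightarrow> w \<in> H \<Longrightarrow> ip (u + v) w = ip u w + ip v w"
    and ip_scale: "\<And>c u w. u \<in> H \<Longrightarrow> w \<in> H \<Longrightarrow> ip (scale c u) w = c * ip u w"
    and ip_commute: "\<And>u w. u \<in> H \<Longrightarrow> w \<in> H \<Longrightarrow> ip u w = ip w u"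
    and ip_pos: "\<And>u. u \<in> H \<Longrightarrow> u \<noteq> 0 \<Longrightarrow> 0 < ip u u"
begin

lemma ip_scale_right: "u \<in> H \<Longrightarrow> w \<in> H \<Longrightarrow> ip w (scale c u) = c * ip w u"
  using ip_scale[of u w] ip_commute subspace_scale[OF subspace_H] by metis

lemma ip_diff: "u \<in> H \<Longrightarrow> v \<in> H \<Longrightarrow> w \<in> H \<Longrightarrow> ip (u - v) w = ip u w - ip v w"
  using ip_add[of "u - v" v w] subspace_diff[OF subspace_H] by simp

lemma ip_zero: "w \<in> H \<Longrightarrow> ip 0 w = 0"
  using ip_scale[of w w 0] by simp

lemma ip_nonneg: "u \<in> H \<Longrightarrow> 0 \<le> ip u u"
  using ip_pos[of u] ip_zero[of u] by (cases "u = 0") auto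

lemma ip_sum:
  assumes "finite I" "f ` I \<subseteq> H" "w \<in> H"
  shows "ip (\<Sum>i\<in>I. scale (c i) (f i)) w = (\<Sum>i\<in>I. c i * ip (f i) w)"
  using assms(1,2)
proof (induction I)
  case empty
  then show ?case by (simp add: ip_zero assms(3))
next
  case (insert i I)
  then show ?case using assms(3)
    by (simp add: ip_add ip_scale subspace_scale[OF subspace_H] subspace_sum[OF subspace_H] image_subset_iff)
qed

section \<open>Eigenvectors of symmetric operators\<close>

lemma annihilating_poly_exists:
  assumes W: "W \<subseteq> H" "w \<in> W" "T ` W \<subseteq> W"
  shows "\<exists>p. p \<noteq> 0 \<and> op_poly scale T p w = 0"
proof -
  have TW: "(T ^^ i) w \<in> W" for i
    using W by (induction i) auto
  \<comment> \<open>There are \<open>card B + 1\<close> iterates in the span of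
    \<open>card B\<close> vectors.\<close>
  have "\<exists>u. (\<exists>i\<in>{..card B}. u i \<noteq> 0) \<and> (\<Sum>i\<in>{..card B}. scale (u i) ((T ^^ i) w)) = 0"
    using TW W(1) H_span finite_B by (intro linear_relation_exists[of B]) auto
  then obtain u where u: "\<exists>i\<le>card B. u i \<noteq> 0" "(\<Sum>i\<le>card B. scale (u i) ((T ^^ i) w)) = 0"
    by auto
  define p where "p = (\<Sum>i\<le>card B. monom (u i) i)"
  have cp: "coeff p i = (if i \<le> card B then u i else 0)" for i
    by (simp add: p_def coeff_sum sum.delta)
  then have "degree p \<le> card B" by (intro degree_le) auto
  then have "op_poly scale T p w = 0" using u(2) by (simp add: op_poly_bound[of _ "card B"] cp)
  moreover have "p \<noteq> 0" using u(1) cp by (metis coeff_0)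
  ultimately show ?thesis by blast
qed

text \<open>A nonzero annihilating polynomial of minimal degree cannot have a factor
  \<open>(x - a)\<^sup>2 + b\<^sup>2\<close> with \<open>b \<noteq> 0\<close>, because \<open>(T - a)\<^sup>2 + b\<^sup>2\<close> is positive definite.\<close>

lemma symmetric_operator_eigenvector:
  assumes T: "Vector_Spaces.linear scale scale T"
    and W: "subspace W" "W \<subseteq> H" "T ` W \<subseteq> W" "u' \<in> W" "u' \<noteq> 0"
    and sym: "\<And>u v. u \<in> W \<Longrightarrow> v \<in> W \<Longrightarrow> ip (T u) v = ip u (T v)"
  shows "\<exists>a w. w \<in> W \<and> w \<noteq> 0 \<and> T w = scale a w"
proof -
  \<comment> \<open>The degree is minimised over \<open>p\<close> and the annihilated vector
    together: any nonzero vector of \<open>W\<close> may serve.\<close>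
  let ?ann = "\<lambda>p. p \<noteq> 0 \<and> (\<exists>w\<in>W. w \<noteq> 0 \<and> op_poly scale T p w = 0)"
  have "\<exists>p. ?ann p" using annihilating_poly_exists[OF W(2,4,3)] W(4,5) by blast
  then obtain p where p: "?ann p" and least: "\<And>r. ?ann r \<Longrightarrow> degree p \<le> degree r"
    using ex_has_least_nat[of ?ann _ degree] by metis
  obtain w where w: "w \<in> W" "w \<noteq> 0" "op_poly scale T p w = 0" using p by blast
  have TW: "(T ^^ i) w \<in> W" for i
    using W w by (induction i) auto
  have opW: "op_poly scale T r w \<in> W" for r
    unfolding op_poly_def using W(1) TW by (intro subspace_sum subspace_scale) auto
  \<comment> \<open>The cofactor of a non-constant factor has smaller degree than \<open>p\<close>,
    so by minimality it cannot annihilate \<open>w\<close>.\<close>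
  have smaller: "op_poly scale T r w \<noteq> 0" if "p = s * r" "degree s > 0" for r s
  proof
    assume "op_poly scale T r w = 0"
    moreover have "s \<noteq> 0" "r \<noteq> 0" using p that by auto
    ultimately show False using least[of r] w that by (auto simp: degree_mult_eq)
  qed
  have "degree p > 0"
  proof (rule ccontr)
    assume "\<not> degree p > 0"
    then obtain c where "p = [:c:]" by (auto elim: degree_eq_zeroE)
    then show False using w p by (simp add: op_poly_def)
  qed
  then show ?thesis
  proof (cases rule: real_poly_linear_or_quadratic_factor)
    case (1 a)
    then obtain r where r: "p = [:- a, 1:] * r" unfolding dvd_def by blast
    have "T (op_poly scale T r w) = scale a (op_poly scale T r w)"
      using w(3) by (simp only: r op_poly_linear_factor[OF T]) simp
    moreover have "op_poly scale T r w \<noteq> 0" using smaller[OF r] by simp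
    ultimately show ?thesis using opW by blast
  next
    case (2 a b)
    then obtain r where r: "p = [:a\<^sup>2 + b\<^sup>2, - 2 * a, 1:] * r" unfolding dvd_def by blast
    define v where "v = op_poly scale T r w"
    define S where "S = (\<lambda>u. T u - scale a u)"
    have v: "v \<in> W" "v \<noteq> 0" unfolding v_def using opW smaller[OF r] by auto
    have SW: "S u \<in> W" if "u \<in> W" for u
      unfolding S_def using that W by (intro subspace_diff subspace_scale) auto
    have Ssym: "ip (S u) u' = ip u (S u')" if u: "u \<in> W" "u' \<in> W" for u u'
    proof -
      have H: "u \<in> H" "u' \<in> H" "T u \<in> H" "T u' \<in> H" "scale a u \<in> H" "scale a u' \<in> H"
        using u W subspace_scale[OF subspace_H] by auto
      show ?thesis
        using H ip_commute[of "S u'" u] sym[OF u] subspace_diff[OF subspace_H]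
        by (simp add: S_def ip_diff ip_scale ip_commute[of u])
    qed
    \<comment> \<open>Pairing with \<open>v\<close> and moving one \<open>S\<close> across gives |S
      v|^2 + b^2 |v|^2, which is positive.\<close>
    have "0 = S (S v) + scale (b\<^sup>2) v"
      using w(3) by (simp only: r op_poly_quadratic_factor[OF T] v_def S_def)
    then have "0 = ip (S (S v) + scale (b\<^sup>2) v) v"
      using ip_zero v(1) W(2) by auto
    also have "\<dots> = ip (S v) (S v) + b\<^sup>2 * ip v v"
      using v SW[OF v(1)] SW[OF SW[OF v(1)]] W(2) subspace_scale[OF subspace_H]
      by (simp add: ip_add ip_scale Ssym subset_iff)
    also have "\<dots> > 0"
      using ip_nonneg[of "S v"] ip_pos[of v] v SW[OF v(1)] W(2) \<open>b \<noteq> 0\<close>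
      by (intro add_nonneg_pos mult_pos_pos) auto
    finally show ?thesis by simp
  qed
qed

text \<open>Induction over the operators: by commutation the joint eigenspace \<open>V\<close> of
  the earlier ones is invariant under the next one, which therefore has an eigenvector inside
  \<open>V\<close>.\<close>

lemma common_eigenvector:
  assumes K: "finite K"
    and T: "\<And>k. k \<in> K \<Longrightarrow> Vector_Spaces.linear scale scale (T k)"
    and W: "subspace W" "W \<subseteq> H" "u' \<in> W" "u' \<noteq> 0"
    and inv: "\<And>k. k \<in> K \<Longrightarrow> T k ` W \<subseteq> W"
    and sym: "\<And>k u v. k \<in> K \<Longrightarrow> u \<in> W \<Longrightarrow> v \<in> W \<Longrightarrow> ip (T k u) v = ip u (T k v)"
    and comm: "\<And>k l u. k \<in> K \<Longrightarrow> l \<in> K \<Longrightarrow> u \<in> W \<Longrightarrow> T k (T l u) = T l (T k u)"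
  shows "\<exists>a w. w \<in> W \<and> w \<noteq> 0 \<and> (\<forall>k\<in>K. T k w = scale (a k) w)"
  using K T inv sym comm
proof (induction K)
  case empty
  show ?case using W(3,4) by blast
next
  case (insert k K)
  have "\<exists>a w. w \<in> W \<and> w \<noteq> 0 \<and> (\<forall>l\<in>K. T l w = scale (a l) w)"
    by (rule insert.IH; rule insert.prems; (erule insertI2 | assumption))
  then obtain a w where aw: "w \<in> W" "w \<noteq> 0" "\<forall>l\<in>K. T l w = scale (a l) w"
    by blast
  define V where "V = {v\<in>W. \<forall>l\<in>K. T l v = scale (a l) v}"
  have lin: "T l (u + v) = T l u + T l v" "T l (scale c u) = scale c (T l u)" "T l 0 = 0"
    if "l \<in> insert k K" for l u v c
  proof -
    interpret Vector_Spaces.linear scale scale "T l" using insert.prems(1)[OF that] .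
    show "T l (u + v) = T l u + T l v" "T l (scale c u) = scale c (T l u)" "T l 0 = 0"
      by (simp_all add: add scale)
  qed
  have V: "subspace V"
    using W(1) unfolding V_def subspace_def
    by (auto simp: lin scale_right_distrib scale_left_commute)
  have TV: "T k v \<in> V" if "v \<in> V" for v
  proof -
    have v: "v \<in> W" "\<And>l. l \<in> K \<Longrightarrow> T l v = scale (a l) v" using that by (auto simp: V_def)
    have "T l (T k v) = scale (a l) (T k v)" if "l \<in> K" for l
      using insert.prems(4)[of l k v] that v by (simp add: lin)
    then show ?thesis using v insert.prems(2)[of k] by (auto simp: V_def)
  qed
  have "\<exists>b v. v \<in> V \<and> v \<noteq> 0 \<and> T k v = scale b v"
  proof (rule symmetric_operator_eigenvector)
    show "V \<subseteq> H" "w \<in> V" "w \<noteq> 0" using aw W(2) by (auto simp: V_def)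
    show "ip (T k u) v = ip u (T k v)" if "u \<in> V" "v \<in> V" for u v
      using that insert.prems(3)[of k u v] by (simp add: V_def)
  qed (use insert.prems(1) V TV in auto)
  then obtain b v where bv: "v \<in> V" "v \<noteq> 0" "T k v = scale b v" by blast
  then show ?case using insert.hyps
    by (intro exI[of _ "a(k := b)"] exI[of _ v]) (auto simp: V_def)
qed

text \<open>Pairing a linear relation with one member isolates its coefficient, so nonzero
  orthogonal vectors are independent. The bound ensures that a largest orthogonal system
  exists.\<close>

lemma orthogonal_card_le:
  assumes "finite E" "E \<subseteq> H" "0 \<notin> E"
    and orth: "\<And>e f. e \<in> E \<Longrightarrow> f \<in> E \<Longrightarrow> e \<noteq> f \<Longrightarrow> ip e f = 0"
  shows "card E \<le> card B"
proof (rule ccontr)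
  assume "\<not> card E \<le> card B"
  then obtain u where u: "\<exists>e\<in>E. u e \<noteq> 0" "(\<Sum>e\<in>E. scale (u e) e) = 0"
    using linear_relation_exists[of B E "\<lambda>e. e"] assms(1,2) H_span finite_B
    by (auto simp: not_le dest: subset_trans)
  then obtain f where f: "f \<in> E" "u f \<noteq> 0" by blast
  have "0 = ip (\<Sum>e\<in>E. scale (u e) e) f" using u(2) ip_zero f assms by auto
  also have "\<dots> = (\<Sum>e\<in>E. u e * ip e f)"
    using f assms by (intro ip_sum) auto
  also have "\<dots> = (\<Sum>e\<in>{f}. u e * ip e f)"
    using f assms by (intro sum.mono_neutral_right) auto
  finally show False using f ip_pos[of f] assms by auto
qed

text \<open>Take a largest orthogonal system of common eigenvectors. By symmetry its orthogonal
  complement is invariant, and a nonzero complement would contain one more common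
  eigenvector.\<close>

theorem orthogonal_common_eigenbasis:
  assumes K: "finite K"
    and T: "\<And>k. k \<in> K \<Longrightarrow> Vector_Spaces.linear scale scale (T k)"
    and inv: "\<And>k. k \<in> K \<Longrightarrow> T k ` H \<subseteq> H"
    and sym: "\<And>k u v. k \<in> K \<Longrightarrow> u \<in> H \<Longrightarrow> v \<in> H \<Longrightarrow> ip (T k u) v = ip u (T k v)"
    and comm: "\<And>k l u. k \<in> K \<Longrightarrow> l \<in> K \<Longrightarrow> u \<in> H \<Longrightarrow> T k (T l u) = T l (T k u)"
  obtains E a where "finite E" "E \<subseteq> H" "0 \<notin> E"
    "\<And>e f. e \<in> E \<Longrightarrow> f \<in> E \<Longrightarrow> e \<noteq> f \<Longrightarrow> ip e f = 0"
    "\<And>e k. e \<in> E \<Longrightarrow> k \<in> K \<Longrightarrow> T k e = scale (a e k) e"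
    "\<And>w. w \<in> H \<Longrightarrow> w = (\<Sum>e\<in>E. scale (ip w e / ip e e) e)"
proof -
  define good where "good E \<longleftrightarrow> finite E \<and> E \<subseteq> H \<and> 0 \<notin> E \<and>
    (\<forall>e\<in>E. \<exists>a. \<forall>k\<in>K. T k e = scale (a k) e) \<and> (\<forall>e\<in>E. \<forall>f\<in>E. e \<noteq> f \<longrightarrow> ip e f = 0)" for E
  have "good {}" by (simp add: good_def)
  moreover have "card E < Suc (card B)" if "good E" for E
    using that orthogonal_card_le[of E] by (auto simp: good_def less_Suc_eq_le)
  ultimately obtain E where E: "good E" and max: "\<And>F. good F \<Longrightarrow> card F \<le> card E"
    using ex_has_greatest_nat[of good "{}" card "Suc (card B)"] by (metis less_imp_le)
  have EH: "finite E" "E \<subseteq> H" "0 \<notin> E" and orth: "\<And>e f. e \<in> E \<Longrightarrow> f \<in> E \<Longrightarrow> e \<noteq> f \<Longrightarrow> ip e f = 0"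
    using E by (auto simp: good_def)
  obtain a where a: "\<And>e k. e \<in> E \<Longrightarrow> k \<in> K \<Longrightarrow> T k e = scale (a e k) e"
    using E unfolding good_def by metis
  define W where "W = {w\<in>H. \<forall>e\<in>E. ip w e = 0}"
  have W: "subspace W" "W \<subseteq> H"
    using subspace_H EH unfolding W_def subspace_def
    by (auto simp: ip_zero ip_add ip_scale subset_iff)
  have W0: "w = 0" if "w \<in> W" for w
  proof (rule ccontr)
    assume "w \<noteq> 0"
    have invW: "T k ` W \<subseteq> W" if "k \<in> K" for k
    proof
      fix v assume "v \<in> T k ` W"
      then obtain u where u: "u \<in> W" "v = T k u" by blast
      \<comment> \<open>Symmetry moves \<open>T k\<close> onto the eigenvector \<open>e\<close>,
        which it only rescales.\<close>
      have "ip (T k u) e = 0" if "e \<in> E" for e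
        using u that EH \<open>k \<in> K\<close> sym[of k u e] a[of e k]
        by (auto simp: W_def ip_scale_right)
      then show "v \<in> W" using u inv[OF that] by (auto simp: W_def)
    qed
    have "\<exists>b v. v \<in> W \<and> v \<noteq> 0 \<and> (\<forall>k\<in>K. T k v = scale (b k) v)"
    proof (rule common_eigenvector[OF K T W that \<open>w \<noteq> 0\<close> invW])
      show "ip (T k u) v = ip u (T k v)" if "k \<in> K" "u \<in> W" "v \<in> W" for k u v
        using sym that W(2) by blast
      show "T k (T l u) = T l (T k u)" if "k \<in> K" "l \<in> K" "u \<in> W" for k l u
        using comm that W(2) by blast
    qed
    then obtain b v where v: "v \<in> W" "v \<noteq> 0" "\<forall>k\<in>K. T k v = scale (b k) v" by blast
    have vE: "v \<notin> E"
      using v ip_pos[of v] W(2) by (force simp: W_def)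
    have "ip e v = 0" if "e \<in> E" for e
      using that v EH ip_commute[of e v] by (auto simp: W_def)
    then have "good (insert v E)"
      using E v W unfolding good_def by (auto simp: W_def)
    then show False using max[of "insert v E"] EH vE by simp
  qed
  have "w = (\<Sum>e\<in>E. scale (ip w e / ip e e) e)" if w: "w \<in> H" for w
  proof -
    let ?s = "\<Sum>e\<in>E. scale (ip w e / ip e e) e"
    have s: "?s \<in> H"
      using EH by (intro subspace_sum[OF subspace_H] subspace_scale[OF subspace_H]) auto
    have "ip (w - ?s) f = 0" if f: "f \<in> E" for f
    proof -
      have "ip ?s f = (\<Sum>e\<in>E. ip w e / ip e e * ip e f)"
        using f EH by (intro ip_sum) auto
      also have "\<dots> = (\<Sum>e\<in>{f}. ip w e / ip e e * ip e f)"
        using f EH orth by (intro sum.mono_neutral_right) auto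
      also have "\<dots> = ip w f"
      proof -
        have "f \<in> H" "f \<noteq> 0" using f EH by auto
        then show ?thesis using ip_pos[of f] by simp
      qed
      finally show ?thesis using w s f EH by (auto simp: ip_diff)
    qed
    \<comment> \<open>The residual of the orthogonal expansion is orthogonal to \<open>E\<close>,
      hence zero by \<open>W0\<close>.\<close>
    then have "w - ?s \<in> W" using w s subspace_diff[OF subspace_H] by (auto simp: W_def)
    then show ?thesis using W0 by fastforce
  qed
  then show thesis using that[OF EH orth a] by blast
qed

end

subsection \<open>Rank of a weighted sum of rank-one matrices\<close>

context vector_space
begin

text \<open>A vector of \<open>V\<close> outside \<open>span D\<close> could be adjoined to
  \<open>D\<close>, giving an independent set larger than a basis of \<open>V\<close>.\<close>

lemma independent_card_ge_dim_spans:
  assumes "independent D" "D \<subseteq> span V" "finite V" "dim V \<le> card D"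
  shows "V \<subseteq> span D"
proof
  fix v assume v: "v \<in> V"
  obtain A where A: "A \<subseteq> V" "independent A" "V \<subseteq> span A" "card A = dim V"
    by (rule basis_exists)
  have fA: "finite A" using A(1) assms(3) finite_subset by blast
  have VA: "span V \<subseteq> span A" using A(3) span_minimal subspace_span by blast
  have fD: "finite D" using independent_span_bound[OF fA assms(1)] assms(2) VA by blast
  show "v \<in> span D"
  proof (rule ccontr)
    assume n: "v \<notin> span D"
    then have "independent (insert v D)" using assms(1) by (rule independent_insertI)
    moreover have "insert v D \<subseteq> span A" using v A(3) assms(2) VA by blast
    ultimately have "card (insert v D) \<le> card A" using independent_span_bound[OF fA] by blast
    moreover have "v \<notin> D" using n span_base by blast
    ultimately show False using fD A(4) assms(4) by simp
  qed
qed

text \<open>The coefficients are indexed by \<open>I\<close> rather than by the image, so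
  \<open>f\<close> may repeat values.\<close>

lemma span_image_finite_combination:
  assumes "v \<in> span (f ` I)" "finite I"
  shows "\<exists>u. v = (\<Sum>i\<in>I. scale (u i) (f i))"
proof -
  let ?S = "range (\<lambda>u. \<Sum>i\<in>I. scale (u i) (f i))"
  have "subspace ?S"
  proof (rule subspaceI)
    show "0 \<in> ?S" by (rule range_eqI[of _ _ "\<lambda>_. 0"]) simp
    show "x + y \<in> ?S" if "x \<in> ?S" "y \<in> ?S" for x y
    proof -
      obtain u w where "x = (\<Sum>i\<in>I. scale (u i) (f i))" "y = (\<Sum>i\<in>I. scale (w i) (f i))"
        using \<open>x \<in> ?S\<close> \<open>y \<in> ?S\<close> by blast
      then show ?thesis
        by (intro range_eqI[of _ _ "\<lambda>i. u i + w i"]) (simp add: scale_left_distrib sum.distrib)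
    qed
    show "scale c x \<in> ?S" if "x \<in> ?S" for c x
    proof -
      obtain u where "x = (\<Sum>i\<in>I. scale (u i) (f i))" using \<open>x \<in> ?S\<close> by blast
      then show ?thesis by (intro range_eqI[of _ _ "\<lambda>i. c * u i"]) (simp add: scale_sum_right)
    qed
  qed
  moreover have "f ` I \<subseteq> ?S"
  proof
    fix x assume "x \<in> f ` I"
    then obtain j where j: "j \<in> I" "x = f j" by blast
    then have "x = (\<Sum>i\<in>{j}. scale (if i = j then 1 else 0) (f i))" by simp
    also have "\<dots> = (\<Sum>i\<in>I. scale (if i = j then 1 else 0) (f i))"
      using j assms(2) by (intro sum.mono_neutral_left) auto
    finally show "x \<in> ?S" by (intro range_eqI[of _ _ "\<lambda>i. if i = j then 1 else 0"])
  qed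
  ultimately have "span (f ` I) \<subseteq> ?S" by (intro span_minimal)
  then show ?thesis using assms(1) by blast
qed

lemma independent_image_coeff_zero:
  assumes "independent (f ` I)" "inj_on f I" "finite I" "(\<Sum>i\<in>I. scale (u i) (f i)) = 0" "i \<in> I"
  shows "u i = 0"
proof -
  have "(\<Sum>v\<in>f ` I. scale (u (the_inv_into I f v)) v) = 0"
    using assms by (simp add: sum.reindex the_inv_into_f_f)
  then have "u (the_inv_into I f (f i)) = 0"
    using independentD[OF assms(1), of "f ` I" "\<lambda>v. u (the_inv_into I f v)" "f i"] assms by auto
  then show ?thesis using assms by (simp add: the_inv_into_f_f)
qed

end

interpretation fun_space: vector_space fun_scale
  by (rule vector_space_fun_scale)

lemma sum_fun_apply: "(\<Sum>x\<in>A. f x) t = (\<Sum>x\<in>A. f x t)"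
  for f :: "'a \<Rightarrow> 'b \<Rightarrow> 'c::comm_monoid_add"
  by (induction A rule: infinite_finite_induct) auto

lemma fun_scale_apply: "fun_scale c f t = c * f t"
  by (simp add: fun_scale_def)

text \<open>One setting for two kinds of matrices: \<open>f x\<close> becomes the vector of
  monomials at the atom \<open>x\<close>, weights \<open>\<rho> x\<close> give a moment matrix, and
  weights \<open>\<rho> x * poly_val q x\<close>, of either sign, a localizing matrix.\<close>

context
  fixes I :: "'a set" and X :: "'b set" and A :: "'a \<Rightarrow> 'a \<Rightarrow> real"
    and w :: "'b \<Rightarrow> real" and f :: "'b \<Rightarrow> 'a \<Rightarrow> real"
  assumes fin: "finite I" "finite X"
    and A_eq: "\<And>i j. i \<in> I \<Longrightarrow> j \<in> I \<Longrightarrow> A i j = (\<Sum>x\<in>X. w x * f x i * f x j)"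
begin

text \<open>The zeros outside \<open>I\<close> match the padded columns in
  \<open>mat_rank\<close>.\<close>

private definition g where "g x = (\<lambda>i. if i \<in> I then f x i else 0)"
private definition col where "col j = (\<lambda>i. if i \<in> I then A i j else 0)"

private lemma mat_rank_col: "mat_rank I A = fun_space.dim (col ` I)"
  by (simp add: mat_rank_def col_def [abs_def])

private lemma col_eq: "j \<in> I \<Longrightarrow> col j = (\<Sum>x\<in>X. fun_scale (w x * f x j) (g x))"
  by (auto simp: col_def g_def A_eq fun_eq_iff sum_fun_apply fun_scale_apply mult_ac intro!: sum.cong)

private lemma col_span: "col ` I \<subseteq> fun_space.span (g ` {x\<in>X. w x \<noteq> 0})"
proof clarify
  fix j assume j: "j \<in> I"
  have "(\<Sum>x\<in>X. fun_scale (w x * f x j) (g x)) = (\<Sum>x\<in>{x\<in>X. w x \<noteq> 0}. fun_scale (w x * f x j) (g x))"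
    using fin by (intro sum.mono_neutral_right) auto
  then show "col j \<in> fun_space.span (g ` {x\<in>X. w x \<noteq> 0})"
    unfolding col_eq[OF j]
    by (auto intro: fun_space.span_sum fun_space.span_scale fun_space.span_base)
qed

lemma mat_rank_le_card: "mat_rank I A \<le> card X"
proof -
  have "mat_rank I A \<le> card (g ` {x\<in>X. w x \<noteq> 0})"
    unfolding mat_rank_col using col_span fin by (intro fun_space.dim_le_card) auto
  also have "\<dots> \<le> card {x\<in>X. w x \<noteq> 0}" using fin by (intro card_image_le) auto
  also have "\<dots> \<le> card X" using fin by (intro card_mono) auto
  finally show ?thesis .
qed

text \<open>The dual vectors show that the \<open>g x\<close> are independent. Applying
  \<open>A\<close> to \<open>p x\<close> gives \<open>w x\<close> times \<open>g x\<close>, so the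
  vectors of nonzero weight form a basis of the column space.\<close>

lemma mat_rank_eq_card_nonzero_weights:
  assumes dual: "\<And>x y. x \<in> X \<Longrightarrow> y \<in> X \<Longrightarrow> (\<Sum>i\<in>I. p x i * f y i) = of_bool (x = y)"
  shows "mat_rank I A = card {x\<in>X. w x \<noteq> 0}"
proof -
  let ?Y = "{x\<in>X. w x \<noteq> 0}"
  have dual': "(\<Sum>i\<in>I. p x i * g y i) = of_bool (x = y)" if "x \<in> X" "y \<in> X" for x y
    using dual[OF that] by (simp add: g_def)
  have inj: "inj_on g X"
  proof (rule inj_onI)
    fix x y assume "x \<in> X" "y \<in> X" "g x = g y"
    then show "x = y" using dual'[of x x] dual'[of x y] by (auto split: if_splits)
  qed
  have "fun_space.independent (g ` ?Y)"
  proof (rule fun_space.independent_if_scalars_zero)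
    show "finite (g ` ?Y)" using fin by auto
    fix u v assume s: "(\<Sum>v\<in>g ` ?Y. fun_scale (u v) v) = 0" and "v \<in> g ` ?Y"
    then obtain x where x: "x \<in> X" "w x \<noteq> 0" "v = g x" by blast
    have s': "(\<Sum>y\<in>?Y. fun_scale (u (g y)) (g y)) = 0"
      using s inj by (subst (asm) sum.reindex) (auto intro: inj_on_subset)
    \<comment> \<open>Pairing the relation with \<open>p x\<close> isolates the coefficient at
      \<open>x\<close>.\<close>
    have "0 = (\<Sum>i\<in>I. p x i * (\<Sum>y\<in>?Y. fun_scale (u (g y)) (g y)) i)"
      unfolding s' by simp
    also have "\<dots> = (\<Sum>i\<in>I. \<Sum>y\<in>?Y. u (g y) * (p x i * g y i))"
      by (simp add: sum_fun_apply fun_scale_apply sum_distrib_left mult_ac)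
    also have "\<dots> = (\<Sum>y\<in>?Y. u (g y) * (\<Sum>i\<in>I. p x i * g y i))"
      by (subst sum.swap) (simp add: sum_distrib_left)
    also have "\<dots> = (\<Sum>y\<in>?Y. if y = x then u (g y) else 0)"
      using x by (intro sum.cong) (auto simp: dual')
    also have "\<dots> = u v" using x fin by simp
    finally show "u v = 0" by simp
  qed
  moreover have "g ` ?Y \<subseteq> fun_space.span (col ` I)"
  proof clarify
    fix x assume x: "x \<in> X" "w x \<noteq> 0"
    have "(\<Sum>j\<in>I. fun_scale (p x j) (col j)) = fun_scale (w x) (g x)"
    proof
      fix i
      have "(\<Sum>j\<in>I. fun_scale (p x j) (col j)) i
          = (\<Sum>j\<in>I. \<Sum>y\<in>X. w y * g y i * (p x j * f y j))"
        by (auto simp: sum_fun_apply fun_scale_apply col_eq sum_distrib_left mult_ac intro!: sum.cong)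
      also have "\<dots> = (\<Sum>y\<in>X. w y * g y i * (\<Sum>j\<in>I. p x j * f y j))"
        by (subst sum.swap) (simp add: sum_distrib_left)
      also have "\<dots> = (\<Sum>y\<in>X. if y = x then w y * g y i else 0)"
        using x by (intro sum.cong) (auto simp: dual)
      also have "\<dots> = fun_scale (w x) (g x) i" using x fin by (simp add: fun_scale_apply)
      finally show "(\<Sum>j\<in>I. fun_scale (p x j) (col j)) i = fun_scale (w x) (g x) i" .
    qed
    then have "g x = fun_scale (1 / w x) (\<Sum>j\<in>I. fun_scale (p x j) (col j))"
      using x by (simp add: fun_scale_def)
    moreover have "fun_scale (1 / w x) (\<Sum>j\<in>I. fun_scale (p x j) (col j)) \<in> fun_space.span (col ` I)"
      by (intro fun_space.span_sum fun_space.span_scale fun_space.span_base imageI)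
    ultimately show "g x \<in> fun_space.span (col ` I)" by simp
  qed
  moreover from this have "fun_space.span (g ` ?Y) = fun_space.span (col ` I)"
    using col_span by (intro subset_antisym fun_space.span_minimal fun_space.subspace_span)
  ultimately have "fun_space.dim (col ` I) = card (g ` ?Y)"
    by (intro fun_space.dim_eq_card)
  also have "\<dots> = card ?Y" using inj by (intro card_image) (auto intro: inj_on_subset)
  finally show ?thesis by (simp add: mat_rank_col)
qed

text \<open>If the rank equals the number of atoms, the \<open>g x\<close> are a basis of the column
  space. Each is then \<open>A\<close> applied to some vector \<open>u\<close>, and
  \<open>w x\<close> times \<open>u\<close> is the dual vector.\<close>

lemma dual_vectors_exist:
  assumes w: "\<And>x. x \<in> X \<Longrightarrow> w x \<noteq> 0" and rank: "mat_rank I A = card X"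
  obtains p where "\<And>x y. x \<in> X \<Longrightarrow> y \<in> X \<Longrightarrow> (\<Sum>i\<in>I. p x i * f y i) = of_bool (x = y)"
proof -
  have X: "{x\<in>X. w x \<noteq> 0} = X" using w by auto
  have sp: "col ` I \<subseteq> fun_space.span (g ` X)" using col_span unfolding X .
  obtain D where D: "D \<subseteq> col ` I" "fun_space.independent D" "col ` I \<subseteq> fun_space.span D"
    "card D = card X"
    using fun_space.basis_exists[of "col ` I"] rank mat_rank_col by metis
  obtain C where C: "C \<subseteq> g ` X" "fun_space.independent C" "g ` X \<subseteq> fun_space.span C"
    "card C = fun_space.dim (g ` X)"
    by (rule fun_space.basis_exists)
  have fC: "finite C" "finite (g ` X)" using C(1) fin finite_subset by auto
  have spanC: "fun_space.span (g ` X) \<subseteq> fun_space.span C"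
    by (rule fun_space.span_minimal[OF C(3) fun_space.subspace_span])
  \<comment> \<open>\<open>D\<close> consists of \<open>card X\<close> independent vectors in the
    span of \<open>C\<close>. Since \<open>C\<close> lies in the image of \<open>X\<close> under
    \<open>g\<close>, all cardinalities coincide; so \<open>g\<close> is injective and its image
    independent.\<close>
  have "card X \<le> card C"
    using fun_space.independent_span_bound[OF fC(1) D(2)] D sp spanC by fastforce
  moreover have "card C \<le> card (g ` X)" using C(1) fC by (intro card_mono)
  moreover have "card (g ` X) \<le> card X" by (rule card_image_le[OF fin(2)])
  ultimately have eq: "card (g ` X) = card X" "card C = card (g ` X)" by auto
  then have inj: "inj_on g X" using fin by (intro eq_card_imp_inj_on)
  have "C = g ` X" using C(1) eq(2) fC by (intro card_subset_eq)
  then have ind: "fun_space.independent (g ` X)" using C by simp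
  have "g ` X \<subseteq> fun_space.span D"
  proof (rule fun_space.independent_card_ge_dim_spans[OF D(2) _ fC(2)])
    show "D \<subseteq> fun_space.span (g ` X)" using D(1) sp by (rule subset_trans)
    show "fun_space.dim (g ` X) \<le> card D" using C(4) D(4) eq by simp
  qed
  also have "\<dots> \<subseteq> fun_space.span (col ` I)" using D(1) by (rule fun_space.span_mono)
  finally have gsp: "g ` X \<subseteq> fun_space.span (col ` I)" .
  have "\<exists>c. \<forall>y\<in>X. (\<Sum>j\<in>I. c j * f y j) = of_bool (x = y)" if x: "x \<in> X" for x
  proof -
    have "g x \<in> fun_space.span (col ` I)" using gsp x by blast
    from fun_space.span_image_finite_combination[OF this fin(1)]
    obtain u where u: "g x = (\<Sum>j\<in>I. fun_scale (u j) (col j))" by blast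
    \<comment> \<open>\<open>?c y\<close> is the coefficient of \<open>g y\<close> in
      \<open>A\<close> applied to \<open>u\<close>; independence forces it to be 1 at
      \<open>y = x\<close> and 0 elsewhere.\<close>
    let ?c = "\<lambda>y. w y * (\<Sum>j\<in>I. u j * f y j)"
    have "(\<Sum>y\<in>X. fun_scale (?c y - of_bool (x = y)) (g y)) i = 0" for i
    proof -
      have "(\<Sum>y\<in>X. fun_scale (?c y) (g y)) i = (\<Sum>y\<in>X. \<Sum>j\<in>I. u j * (w y * f y j * g y i))"
        by (simp add: sum_fun_apply fun_scale_apply sum_distrib_left sum_distrib_right mult_ac)
      also have "\<dots> = (\<Sum>j\<in>I. u j * (\<Sum>y\<in>X. w y * f y j * g y i))"
        by (subst sum.swap) (simp add: sum_distrib_left)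
      also have "\<dots> = g x i"
        unfolding u by (simp add: sum_fun_apply fun_scale_apply col_eq)
      finally have "(\<Sum>y\<in>X. ?c y * g y i) = g x i"
        by (simp add: sum_fun_apply fun_scale_apply)
      moreover have "(\<Sum>y\<in>X. of_bool (x = y) * g y i) = g x i"
        using x fin by (subst sum.cong[OF refl, of _ _ "\<lambda>y. if y = x then g y i else 0"]) auto
      ultimately show ?thesis
        by (simp add: sum_fun_apply fun_scale_apply left_diff_distrib sum_subtractf)
    qed
    then have "(\<Sum>y\<in>X. fun_scale (?c y - of_bool (x = y)) (g y)) = 0" by auto
    then have c: "?c y = of_bool (x = y)" if "y \<in> X" for y
      using fun_space.independent_image_coeff_zero[OF ind inj fin(2) _ that,
          of "\<lambda>y. ?c y - of_bool (x = y)"] by simp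
    have "(\<Sum>j\<in>I. (w x * u j) * f y j) = of_bool (x = y)" if y: "y \<in> X" for y
    proof -
      have "(\<Sum>j\<in>I. (w x * u j) * f y j) = w x * (\<Sum>j\<in>I. u j * f y j)"
        by (simp add: sum_distrib_left mult_ac)
      \<comment> \<open>For \<open>y \<noteq> x\<close> the nonzero weight \<open>w y\<close>
        cancels; for \<open>y = x\<close> it is the factor already present.\<close>
      then show ?thesis using c[OF y] w[OF y] by (cases "x = y") auto
    qed
    then show ?thesis by (intro exI[of _ "\<lambda>j. w x * u j"]) blast
  qed
  then show thesis using that by metis
qed

end

subsection \<open>Multi-indices and monomials\<close>

lemma mdeg_0 [simp]: "mdeg 0 = 0"
  by (simp add: mdeg_def)

lemma mdeg_add: "mdeg (i + j) = mdeg i + mdeg j"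
  by (simp add: mdeg_def sum.distrib)

definition unit_index :: "'n::finite \<Rightarrow> 'n mindex" where
  "unit_index k = axis k 1"

lemma mdeg_unit_index [simp]: "mdeg (unit_index k) = 1"
  by (simp add: mdeg_def unit_index_def axis_def sum.delta)

lemma zero_in_mindices [simp]: "0 \<in> mindices d"
  by (simp add: mindices_def)

lemma mindices_mono: "d \<le> e \<Longrightarrow> mindices d \<subseteq> mindices e"
  by (auto simp: mindices_def)

lemma add_in_mindices: "i \<in> mindices a \<Longrightarrow> j \<in> mindices b \<Longrightarrow> a + b \<le> c \<Longrightarrow> i + j \<in> mindices c"
  by (simp add: mindices_def mdeg_add)

lemma add_unit_index_in_mindices: "i \<in> mindices d \<Longrightarrow> i + unit_index k \<in> mindices (Suc d)"
  by (simp add: mindices_def mdeg_add)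

lemma monom_val_0 [simp]: "monom_val t 0 = 1"
  by (simp add: monom_val_def)

lemma monom_val_add: "monom_val t (i + j) = monom_val t i * monom_val t j"
  by (simp add: monom_val_def power_add prod.distrib)

lemma monom_val_unit_index [simp]: "monom_val t (unit_index k) = t $ k"
proof -
  have "monom_val t (unit_index k) = (\<Prod>l\<in>UNIV. if l = k then t $ l else 1)"
    unfolding monom_val_def by (rule prod.cong) (auto simp: unit_index_def axis_def)
  then show ?thesis by simp
qed

lemma mindex_unit_index_cases:
  fixes i :: "'n::finite mindex"
  assumes "i \<noteq> 0"
  obtains k i' where "i = i' + unit_index k" "mdeg i = Suc (mdeg i')"
proof -
  obtain k where k: "i $ k \<noteq> 0" using assms by (auto simp: vec_eq_iff)
  define i' where "i' = (\<chi> l. if l = k then i $ l - 1 else i $ l)"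
  have "i = i' + unit_index k" using k by (auto simp: vec_eq_iff i'_def unit_index_def axis_def)
  then show thesis using that[of i' k] by (simp add: mdeg_add)
qed

text \<open>Unit indices are peeled off \<open>s\<close> one at a time. Consequently every moment of
  degree at most 2(n + 1) occurs as an entry of \<open>M(n+1)\<close>.\<close>

lemma mindices_split:
  fixes s :: "'n::finite mindex"
  assumes "s \<in> mindices (a + b)"
  obtains i j where "s = i + j" "i \<in> mindices a" "j \<in> mindices b"
proof -
  have "\<exists>i j. s = i + j \<and> i \<in> mindices a \<and> j \<in> mindices b"
    using assms
  proof (induction a arbitrary: s)
    case 0
    then show ?case by (intro exI[of _ 0] exI[of _ s]) simp
  next
    case (Suc a)
    show ?case
    proof (cases "s = 0")
      case True
      then show ?thesis by (intro exI[of _ 0]) simp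
    next
      case False
      then obtain k s' where s: "s = s' + unit_index k" "mdeg s = Suc (mdeg s')"
        by (rule mindex_unit_index_cases)
      then have "s' \<in> mindices (a + b)" using Suc.prems by (simp add: mindices_def)
      then obtain i j where ij: "s' = i + j" "i \<in> mindices a" "j \<in> mindices b"
        using Suc.IH by blast
      then have "s = (i + unit_index k) + j" by (simp add: s add_ac)
      then show ?thesis using ij add_unit_index_in_mindices[OF ij(2)] by fastforce
    qed
  qed
  then show thesis using that by blast
qed

text \<open>The moment sequence of the measure with mass \<open>\<rho> x\<close> at each
  \<open>x\<close> in \<open>X\<close>.\<close>

definition atomic_moments :: "(real ^ 'n::finite) set \<Rightarrow> (real ^ 'n \<Rightarrow> real) \<Rightarrow> 'n mindex \<Rightarrow> real" where
  "atomic_moments X \<rho> i = (\<Sum>x\<in>X. \<rho> x * monom_val x i)"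

text \<open>Each atom contributes one matrix of rank at most one.\<close>

lemma moment_rank_le_card_atoms:
  assumes "finite X" "\<And>i. i \<in> mindices (2 * n) \<Longrightarrow> \<beta> i = atomic_moments X \<rho> i"
  shows "moment_rank n \<beta> \<le> card X"
  unfolding moment_rank_def
proof (rule mat_rank_le_card[OF finite_mindices assms(1), where w = \<rho> and f = monom_val])
  fix i j :: "'a mindex" assume "i \<in> mindices n" "j \<in> mindices n"
  then have "i + j \<in> mindices (2 * n)" by (rule add_in_mindices) simp
  then show "moment_matrix \<beta> i j = (\<Sum>x\<in>X. \<rho> x * monom_val x i * monom_val x j)"
    by (simp add: moment_matrix_def assms(2) atomic_moments_def monom_val_add mult.assoc)
qed

subsection \<open>Flat extensions of moment matrices\<close>

text \<open>Positivity is stated at level \<open>n\<close>. Flatness expresses every column of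
  \<open>M(n+1)\<close> through those of degree at most \<open>n\<close>, so the quadratic form of
  \<open>M(n)\<close> governs the whole column space.\<close>

locale flat_moment_matrix =
  fixes n :: nat and \<sigma> :: "'n::finite mindex \<Rightarrow> real"
  assumes psd: "moment_psd n \<sigma>" and flat: "moment_rank (Suc n) \<sigma> = moment_rank n \<sigma>"
begin

definition col :: "'n mindex \<Rightarrow> 'n mindex \<Rightarrow> real" where
  "col j = (\<lambda>i. if i \<in> mindices (Suc n) then \<sigma> (i + j) else 0)"

definition comb :: "('n mindex \<Rightarrow> real) \<Rightarrow> 'n mindex \<Rightarrow> real" where
  "comb p = (\<Sum>j\<in>mindices n. fun_scale (p j) (col j))"

text \<open>Generated by the columns of degree at most \<open>n\<close>; that the remaining columns
  of \<open>M(n+1)\<close> lie in \<open>H\<close> too is what flatness yields, in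
  \<open>col_in_H\<close>.\<close>

definition H :: "('n mindex \<Rightarrow> real) set" where
  "H = range comb"

lemma comb_apply:
  "comb p i = (if i \<in> mindices (Suc n) then \<Sum>j\<in>mindices n. p j * \<sigma> (i + j) else 0)"
  by (simp add: comb_def sum_fun_apply fun_scale_apply col_def)

lemma linear_comb: "Vector_Spaces.linear fun_scale fun_scale comb"
  by (auto simp: Vector_Spaces.linear_iff vector_space_fun_scale fun_eq_iff comb_apply fun_scale_apply
      sum.distrib sum_distrib_left algebra_simps)

lemma subspace_H: "fun_space.subspace H"
proof -
  interpret comb: Vector_Spaces.linear fun_scale fun_scale comb by (rule linear_comb)
  show ?thesis unfolding H_def by (rule comb.subspace_image) simp
qed

lemma mindices_n_subset [simp]: "i \<in> mindices n \<Longrightarrow> i \<in> mindices (Suc n)"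
  using mindices_mono[of n "Suc n"] by auto

text \<open>Deleting the rows of degree \<open>n + 1\<close> maps \<open>?C0\<close> onto the
  columns of \<open>M(n)\<close>, so \<open>dim ?C0\<close> is at least rank M(n) = rank M(n+1).
  Hence a basis of \<open>?C0\<close> spans all columns of \<open>M(n+1)\<close>.\<close>

lemma col_basis:
  obtains D where "finite D" "card D = moment_rank n \<sigma>" "D \<subseteq> col ` mindices n"
    "col ` mindices (Suc n) \<subseteq> fun_space.span D"
proof -
  let ?C0 = "col ` mindices n" and ?C1 = "col ` mindices (Suc n)"
  define trunc :: "('n mindex \<Rightarrow> real) \<Rightarrow> 'n mindex \<Rightarrow> real"
    where "trunc u = (\<lambda>i. if i \<in> mindices n then u i else 0)" for u
  interpret trunc: Vector_Spaces.linear fun_scale fun_scale trunc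
    by (auto simp: Vector_Spaces.linear_iff vector_space_fun_scale fun_eq_iff trunc_def fun_scale_apply)
  have "trunc ` ?C0 = (\<lambda>j i. if i \<in> mindices n then \<sigma> (i + j) else 0) ` mindices n"
    unfolding image_image
    by (intro image_cong refl) (auto simp: trunc_def col_def fun_eq_iff mindices_n_subset)
  then have r0: "moment_rank n \<sigma> = fun_space.dim (trunc ` ?C0)"
    unfolding moment_rank_def mat_rank_def moment_matrix_def by simp
  have r1: "moment_rank n \<sigma> = fun_space.dim ?C1"
    using flat unfolding moment_rank_def mat_rank_def moment_matrix_def col_def [abs_def] by simp
  obtain D where D: "D \<subseteq> ?C0" "fun_space.independent D" "?C0 \<subseteq> fun_space.span D" "card D = fun_space.dim ?C0"
    by (rule fun_space.basis_exists)
  have fin: "finite D" "finite ?C1"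
    using finite_subset[OF D(1)] finite_mindices by auto
  have sub: "D \<subseteq> ?C1"
    using D(1) image_mono[OF mindices_mono[of n "Suc n"], of col] by auto
  have "trunc ` ?C0 \<subseteq> fun_space.span (trunc ` D)"
    unfolding trunc.span_image using D(3) by (rule image_mono)
  then have "moment_rank n \<sigma> \<le> card (trunc ` D)"
    unfolding r0 using fin by (intro fun_space.dim_le_card) auto
  also have "\<dots> \<le> card D" by (rule card_image_le[OF fin(1)])
  finally have le: "fun_space.dim ?C1 \<le> card D" unfolding r1 .
  have D1: "?C1 \<subseteq> fun_space.span D"
    by (rule fun_space.independent_card_ge_dim_spans[OF D(2) subset_trans[OF sub fun_space.span_superset] fin(2) le])
  have "card D = moment_rank n \<sigma>"
    unfolding r1 using fun_space.basis_card_eq_dim[OF sub D1 D(2)] .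
  then show thesis using that[OF fin(1) _ D(1) D1] by blast
qed

lemma col_in_H: "j \<in> mindices (Suc n) \<Longrightarrow> col j \<in> H"
proof -
  assume j: "j \<in> mindices (Suc n)"
  have "col i \<in> H" if i: "i \<in> mindices n" for i
  proof -
    have "comb (\<lambda>j. of_bool (j = i)) = (\<Sum>j\<in>mindices n. if j = i then col i else 0)"
      unfolding comb_def by (rule sum.cong) auto
    also have "\<dots> = col i" using i by (simp add: finite_mindices)
    finally show ?thesis unfolding H_def by (metis rangeI)
  qed
  moreover obtain D where "D \<subseteq> col ` mindices n" "col ` mindices (Suc n) \<subseteq> fun_space.span D"
    by (rule col_basis)
  ultimately have "col ` mindices (Suc n) \<subseteq> fun_space.span D" "D \<subseteq> H" by auto
  then show ?thesis
    using j fun_space.span_minimal[OF _ subspace_H, of D] by blast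
qed

text \<open>The generating columns may be dependent, so coefficients are not determined by
  \<open>u\<close>. A choice linear in \<open>u\<close> is fixed once, which makes
  \<open>shift\<close>, and \<open>ip\<close> in its first argument, linear.\<close>

definition coords :: "('n mindex \<Rightarrow> real) \<Rightarrow> 'n mindex \<Rightarrow> real" where
  "coords = (SOME R. Vector_Spaces.linear fun_scale fun_scale R \<and> (\<forall>u\<in>H. comb (R u) = u))"

lemma coords: "Vector_Spaces.linear fun_scale fun_scale coords" "u \<in> H \<Longrightarrow> comb (coords u) = u"
proof -
  interpret pair: vector_space_pair fun_scale fun_scale by unfold_locales
  have "\<exists>R. Vector_Spaces.linear fun_scale fun_scale R \<and> (\<forall>u\<in>H. comb (R u) = u)"
    using pair.linear_exists_right_inverse_on[OF linear_comb, of UNIV] unfolding H_def by auto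
  from someI_ex[OF this] show "Vector_Spaces.linear fun_scale fun_scale coords"
    "u \<in> H \<Longrightarrow> comb (coords u) = u"
    unfolding coords_def by auto
qed

lemma coords_add: "coords (u + v) = coords u + coords v"
  using coords(1) by (simp add: Vector_Spaces.linear_iff)

lemma coords_scale: "coords (fun_scale c u) = fun_scale c (coords u)"
  using coords(1) by (simp add: Vector_Spaces.linear_iff)

lemma H_apply:
  "u \<in> H \<Longrightarrow> i \<in> mindices (Suc n) \<Longrightarrow> u i = (\<Sum>j\<in>mindices n. coords u j * \<sigma> (i + j))"
  using coords(2)[of u] comb_apply[of "coords u" i] by simp

lemma H_apply_outside: "u \<in> H \<Longrightarrow> i \<notin> mindices (Suc n) \<Longrightarrow> u i = 0"
  using coords(2)[of u] comb_apply[of "coords u" i] by simp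

text \<open>The inner product with reproducing kernel \<open>M(n+1)\<close>; the reproducing
  property is \<open>ip_col\<close>.\<close>

definition ip :: "('n mindex \<Rightarrow> real) \<Rightarrow> ('n mindex \<Rightarrow> real) \<Rightarrow> real" where
  "ip u w = (\<Sum>j\<in>mindices n. coords u j * w j)"

text \<open>Written through \<open>M(n)\<close> and two coordinate vectors, the form shows its
  symmetry and nonnegativity.\<close>

lemma ip_eq_double_sum:
  assumes "w \<in> H"
  shows "ip u w = (\<Sum>i\<in>mindices n. \<Sum>j\<in>mindices n. coords u i * \<sigma> (i + j) * coords w j)"
  unfolding ip_def using assms
  by (intro sum.cong) (auto simp: H_apply sum_distrib_left sum_distrib_right mult_ac)

lemma ip_commute: "u \<in> H \<Longrightarrow> w \<in> H \<Longrightarrow> ip u w = ip w u"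
  by (simp add: ip_eq_double_sum) (subst sum.swap, simp add: mult_ac add.commute)

lemma ip_col:
  assumes "i \<in> mindices (Suc n)" "w \<in> H"
  shows "ip (col i) w = w i"
proof -
  have "ip w (col i) = w i"
    using assms H_apply[OF assms(2,1)]
    by (simp add: ip_def col_def add.commute)
  then show ?thesis using ip_commute[OF col_in_H assms(2)] assms(1) by simp
qed

lemma ip_add: "ip (u + v) w = ip u w + ip v w"
  and ip_scale: "ip (fun_scale c u) w = c * ip u w"
  by (simp_all add: ip_def coords_add coords_scale fun_scale_apply algebra_simps sum.distrib sum_distrib_left)

lemma ip_nonneg: "u \<in> H \<Longrightarrow> 0 \<le> ip u u"
  using psd by (simp add: ip_eq_double_sum moment_psd_def psd_def moment_matrix_def)

text \<open>Cauchy-Schwarz for a semidefinite form: a null vector is orthogonal to every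
  \<open>col i\<close>, and this pairing is the value \<open>u i\<close>.\<close>

lemma ip_eq_0D:
  assumes u: "u \<in> H" "ip u u = 0"
  shows "u = 0"
proof
  fix i
  show "u i = 0 i"
  proof (cases "i \<in> mindices (Suc n)")
    case True
    define v b c where "v = col i" and "b = ip v u" and "c = ip v v"
    have v: "v \<in> H" using col_in_H[OF True] by (simp add: v_def)
    have c: "0 \<le> c" using ip_nonneg[OF v] by (simp add: c_def)
    \<comment> \<open>The minimiser \<open>- b / c\<close> is replaced by a choice that also makes
      sense for \<open>c = 0\<close>.\<close>
    define t where "t = - b / (c + 1)"
    have z: "u + fun_scale t v \<in> H" "fun_scale t v \<in> H"
      using u v subspace_H by (auto simp: fun_space.subspace_add fun_space.subspace_scale)
    have "0 \<le> ip (u + fun_scale t v) (u + fun_scale t v)" by (rule ip_nonneg[OF z(1)])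
    also have "\<dots> = 2 * t * b + t\<^sup>2 * c"
      using u z v
      by (simp add: ip_add ip_scale ip_commute[of _ "u + fun_scale t v"]
          ip_commute[of _ "fun_scale t v"] ip_commute[of u v] b_def c_def power2_eq_square algebra_simps)
    also have "\<dots> = - (b\<^sup>2 * (c + 2)) / (c + 1)\<^sup>2"
      using c by (simp add: t_def divide_simps power2_eq_square) (simp add: algebra_simps)
    finally have "b\<^sup>2 * (c + 2) \<le> 0"
      using c by (simp add: zero_le_divide_iff divide_le_0_iff)
    then have "b = 0" using c by (simp add: mult_le_0_iff)
    then show ?thesis using ip_col[OF True u(1)] by (simp add: b_def v_def)
  qed (simp add: H_apply_outside u)
qed

text \<open>The squared norm of \<open>u - v\<close> sees only values on \<open>mindices n\<close>;
  definiteness then covers degree \<open>n + 1\<close> as well.\<close>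

lemma H_eqI:
  assumes "u \<in> H" "v \<in> H" "\<And>i. i \<in> mindices n \<Longrightarrow> u i = v i"
  shows "u = v"
proof -
  have "ip (u - v) (u - v) = 0" using assms(3) unfolding ip_def by simp
  moreover have "u - v \<in> H" using assms subspace_H by (simp add: fun_space.subspace_diff)
  ultimately show ?thesis using ip_eq_0D[of "u - v"] by simp
qed

text \<open>Multiplication by the variable t_k, acting on column indices. The rule
  \<open>u (i + unit_index k)\<close> of \<open>shift_apply\<close> makes sense only for
  \<open>i\<close> of degree at most \<open>n\<close>; moving columns also fixes the rows of degree
  \<open>n + 1\<close>.\<close>

definition shift :: "'n \<Rightarrow> ('n mindex \<Rightarrow> real) \<Rightarrow> 'n mindex \<Rightarrow> real" where
  "shift k u = (\<Sum>j\<in>mindices n. fun_scale (coords u j) (col (j + unit_index k)))"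

lemma shift_in_H: "shift k u \<in> H"
  unfolding shift_def using subspace_H
  by (intro fun_space.subspace_sum fun_space.subspace_scale col_in_H add_unit_index_in_mindices)

lemma linear_shift: "Vector_Spaces.linear fun_scale fun_scale (shift k)"
  by (auto simp: Vector_Spaces.linear_iff vector_space_fun_scale shift_def coords_add coords_scale fun_eq_iff
      sum_fun_apply fun_scale_apply sum.distrib sum_distrib_left algebra_simps)

lemma shift_apply_coords:
  "i \<in> mindices (Suc n) \<Longrightarrow> shift k u i = (\<Sum>j\<in>mindices n. coords u j * \<sigma> (i + unit_index k + j))"
  by (simp add: shift_def sum_fun_apply fun_scale_apply col_def add_ac)

lemma shift_apply: "u \<in> H \<Longrightarrow> i \<in> mindices n \<Longrightarrow> shift k u i = u (i + unit_index k)"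
  using H_apply[of u "i + unit_index k"] add_unit_index_in_mindices[of i n k]
  by (simp add: shift_apply_coords mindices_n_subset)

text \<open>By \<open>H_eqI\<close> the rows of degree at most \<open>n\<close> suffice. There both
  sides sum \<open>coords u j * \<sigma> (i + unit_index k + unit_index l + j)\<close> over
  \<open>j\<close>.\<close>

lemma shift_commute:
  assumes "u \<in> H"
  shows "shift k (shift l u) = shift l (shift k u)"
  using assms
  by (intro H_eqI shift_in_H)
    (simp add: shift_apply shift_in_H shift_apply_coords add_unit_index_in_mindices add_ac)

text \<open>Both pairings are the double sum of the two coordinate vectors against
  \<open>\<sigma> (i + unit_index k + j)\<close>, which is symmetric in \<open>i\<close> and
  \<open>j\<close>.\<close>

lemma shift_symmetric:
  assumes "u \<in> H" "w \<in> H"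
  shows "ip (shift k u) w = ip u (shift k w)"
proof -
  have "ip w (shift k u) = ip u (shift k w)"
    unfolding ip_def using assms
    by (simp add: shift_apply_coords sum_distrib_left)
      (subst sum.swap, simp add: mult_ac add_ac)
  then show ?thesis using ip_commute[OF shift_in_H assms(2)] by simp
qed

text \<open>Raising the index by \<open>unit_index k\<close> multiplies the entry of
  \<open>e\<close> by the eigenvalue \<open>x $ k\<close>, so induction on the degree builds the
  monomial.\<close>

lemma eigenvector_eq_monomials:
  assumes e: "e \<in> H" and eig: "\<And>k. shift k e = fun_scale (x $ k) e"
    and i: "i \<in> mindices (Suc n)"
  shows "e i = e 0 * monom_val x i"
  using i
proof (induction "mdeg i" arbitrary: i)
  case 0
  then have "i = 0" using mindex_unit_index_cases[of i] by (metis nat.distinct(1))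
  then show ?case by simp
next
  case (Suc d)
  then have "i \<noteq> 0" by auto
  then obtain k i' where i': "i = i' + unit_index k" "mdeg i = Suc (mdeg i')"
    by (rule mindex_unit_index_cases)
  then have m: "i' \<in> mindices n" using Suc.prems by (simp add: mindices_def)
  have "e i = shift k e i'" using shift_apply[OF e m] i' by simp
  also have "\<dots> = x $ k * e i'" by (simp add: eig fun_scale_apply)
  also have "e i' = e 0 * monom_val x i'"
    using Suc.hyps i' m by (intro Suc.hyps(1)) (auto simp: mindices_n_subset)
  finally show ?case by (simp add: i' monom_val_add)
qed

text \<open>The eigenvalues of a basis vector \<open>e\<close> under the shifts are the coordinates
  of one atom. The orthogonal expansion of \<open>col j\<close> then exhibits
  \<open>\<sigma> (i + j)\<close> as an atomic moment.\<close>

theorem atomic_representation: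
  obtains X \<rho> where "finite X" "card X = moment_rank n \<sigma>" "\<And>x. x \<in> X \<Longrightarrow> 0 < \<rho> x"
    "\<And>i. i \<in> mindices (2 * Suc n) \<Longrightarrow> \<sigma> i = atomic_moments X \<rho> i"
proof -
  obtain D where D: "finite D" "card D = moment_rank n \<sigma>" "D \<subseteq> col ` mindices n"
    "col ` mindices (Suc n) \<subseteq> fun_space.span D"
    by (rule col_basis)
  have "comb p \<in> fun_space.span D" for p
    unfolding comb_def using D(4) mindices_n_subset
    by (intro fun_space.span_sum fun_space.span_scale) blast
  then have HD: "H \<subseteq> fun_space.span D" by (auto simp: H_def)
  interpret definite: definite_subspace fun_scale H ip D
  proof
    show "0 < ip u u" if "u \<in> H" "u \<noteq> 0" for u
      using that ip_nonneg[of u] ip_eq_0D[of u] by force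
  qed (use subspace_H D(1) HD ip_add ip_scale ip_commute in auto)
  obtain E a where E: "finite E" "E \<subseteq> H" "0 \<notin> E"
    and orth: "\<And>e f. e \<in> E \<Longrightarrow> f \<in> E \<Longrightarrow> e \<noteq> f \<Longrightarrow> ip e f = 0"
    and eig: "\<And>e k. e \<in> E \<Longrightarrow> k \<in> UNIV \<Longrightarrow> shift k e = fun_scale (a e k) e"
    and expand: "\<And>w. w \<in> H \<Longrightarrow> w = (\<Sum>e\<in>E. fun_scale (ip w e / ip e e) e)"
    by (rule definite.orthogonal_common_eigenbasis[of "UNIV :: 'n set" shift, OF finite], rule linear_shift,
        simp add: image_subset_iff shift_in_H, erule (1) shift_symmetric, erule shift_commute, rule that)
  define x where "x e = (\<chi> k. a e k)" for e
  have mon: "e i = e 0 * monom_val (x e) i" if "e \<in> E" "i \<in> mindices (Suc n)" for e i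
    using that E eig by (intro eigenvector_eq_monomials) (auto simp: x_def)
  have pos: "0 < ip e e" if "e \<in> E" for e using definite.ip_pos E that by auto
  \<comment> \<open>All entries of \<open>e\<close> are multiples of \<open>e 0\<close>, so
    \<open>e 0 = 0\<close> would give \<open>e = 0\<close>. This makes the weights positive.\<close>
  have e0: "e 0 \<noteq> 0" if e: "e \<in> E" for e
  proof
    assume z: "e 0 = 0"
    have "e i = 0" for i
      using mon[OF e, of i] z H_apply_outside[of e i] E(2) e by (cases "i \<in> mindices (Suc n)") auto
    then have "e = 0" by (simp add: fun_eq_iff)
    then show False using e E(3) by simp
  qed
  \<comment> \<open>Equal eigenvalues would make \<open>e\<close> and \<open>f\<close> proportional,
    against orthogonality.\<close>
  have inj: "inj_on x E"
  proof (rule inj_onI, rule ccontr)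
    fix e f assume ef: "e \<in> E" "f \<in> E" "x e = x f" "e \<noteq> f"
    have EH: "e \<in> H" "f \<in> H" using ef(1,2) E(2) by auto
    have ratio: "e i = e 0 / f 0 * f i" if "i \<in> mindices n" for i
      using mon[OF ef(1), of i] mon[OF ef(2), of i] that e0[OF ef(2)] ef(3) by simp
    have "fun_scale (e 0 / f 0) f \<in> H" by (rule fun_space.subspace_scale[OF subspace_H EH(2)])
    with EH(1) have "e = fun_scale (e 0 / f 0) f"
      by (rule H_eqI) (simp only: fun_scale_apply ratio[symmetric])
    then have "ip e f = e 0 / f 0 * ip f f"
      using ip_scale[of "e 0 / f 0" f f] by (simp only:)
    then show False using orth[OF ef(1,2,4)] e0[OF ef(1)] e0[OF ef(2)] pos[OF ef(2)] by simp
  qed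
  \<comment> \<open>In the expansion \<open>ip (col j) e\<close> equals \<open>e j\<close>, and
    \<open>e i\<close> and \<open>e j\<close> each contribute a factor \<open>e 0\<close>; this
    dictates the weight.\<close>
  define \<rho> where "\<rho> y = (let e = the_inv_into E x y in (e 0)\<^sup>2 / ip e e)" for y
  have \<rho>: "\<rho> (x e) = (e 0)\<^sup>2 / ip e e" if "e \<in> E" for e
    using that inj by (simp add: \<rho>_def the_inv_into_f_f)
  have mom: "\<sigma> s = atomic_moments (x ` E) \<rho> s" if s: "s \<in> mindices (2 * Suc n)" for s
  proof -
    obtain i j where ij: "s = i + j" "i \<in> mindices (Suc n)" "j \<in> mindices (Suc n)"
      using mindices_split[of s "Suc n" "Suc n"] s by (metis mult_2)
    have "\<sigma> s = col j i" using ij by (simp add: col_def)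
    also have "\<dots> = (\<Sum>e\<in>E. ip (col j) e / ip e e * e i)"
      by (subst expand[OF col_in_H[OF ij(3)]]) (simp add: sum_fun_apply fun_scale_apply)
    also have "\<dots> = (\<Sum>e\<in>E. \<rho> (x e) * monom_val (x e) s)"
    proof (rule sum.cong[OF refl])
      fix e assume e: "e \<in> E"
      have "ip (col j) e = e 0 * monom_val (x e) j"
        using ip_col[OF ij(3), of e] mon[OF e ij(3)] e E by auto
      moreover note mon[OF e ij(2)]
      ultimately show "ip (col j) e / ip e e * e i = \<rho> (x e) * monom_val (x e) s"
        by (simp add: \<rho>[OF e] ij(1) monom_val_add power2_eq_square)
    qed
    also have "\<dots> = atomic_moments (x ` E) \<rho> s"
      unfolding atomic_moments_def using inj by (simp add: sum.reindex)
    finally show ?thesis .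
  qed
  \<comment> \<open>The rank bounds the number of atoms from below; orthogonality within the span of
    \<open>D\<close> bounds it from above.\<close>
  have "moment_rank n \<sigma> \<le> card (x ` E)"
    using E mom mindices_mono[of "2 * n" "2 * (Suc n)"]
    by (intro moment_rank_le_card_atoms[where \<rho> = \<rho>]) auto
  moreover have "card (x ` E) \<le> moment_rank n \<sigma>"
    using definite.orthogonal_card_le[OF E orth] D(2) inj by (simp add: card_image)
  ultimately have "card (x ` E) = moment_rank n \<sigma>" by simp
  moreover have "0 < \<rho> y" if "y \<in> x ` E" for y
    using that \<rho> e0 pos by auto
  ultimately show thesis using that[of "x ` E" \<rho>] E(1) mom by blast
qed

end

subsection \<open>Finitely atomic measures\<close>

text \<open>\<open>point_measure\<close> lives on all subsets of \<open>X\<close>; the pushforward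
  along the identity turns it into a Borel measure on the whole space.\<close>

definition discrete_measure :: "'a set \<Rightarrow> ('a \<Rightarrow> real) \<Rightarrow> 'a::topological_space measure" where
  "discrete_measure X \<rho> = distr (point_measure X (\<lambda>x. ennreal (\<rho> x))) borel (\<lambda>x. x)"

lemma sets_discrete_measure [simp]: "sets (discrete_measure X \<rho>) = sets borel"
  by (simp add: discrete_measure_def)

lemma emeasure_discrete_measure:
  assumes "finite X" "A \<in> sets borel"
  shows "emeasure (discrete_measure X \<rho>) A = (\<Sum>x\<in>X \<inter> A. ennreal (\<rho> x))"
proof -
  have "emeasure (discrete_measure X \<rho>) A = emeasure (point_measure X (\<lambda>x. ennreal (\<rho> x))) (A \<inter> X)"
    unfolding discrete_measure_def using assms
    by (subst emeasure_distr) (auto simp: space_point_measure)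
  also have "\<dots> = (\<Sum>x\<in>A \<inter> X. ennreal (\<rho> x))"
    using assms by (intro emeasure_point_measure_finite) auto
  finally show ?thesis by (simp add: Int_commute)
qed

lemma discrete_measure_cong:
  assumes "finite X" "\<And>x. x \<in> X \<Longrightarrow> \<rho> x = \<rho>' x"
  shows "discrete_measure X \<rho> = discrete_measure X \<rho>'"
  using assms by (intro measure_eqI) (auto simp: emeasure_discrete_measure intro!: sum.cong)

lemma integral_discrete_measure:
  fixes f :: "'a::topological_space \<Rightarrow> real"
  assumes "finite X" "\<And>x. x \<in> X \<Longrightarrow> 0 \<le> \<rho> x" and f: "f \<in> borel_measurable borel"
  shows "integrable (discrete_measure X \<rho>) f"
    and "(\<integral>x. f x \<partial>discrete_measure X \<rho>) = (\<Sum>x\<in>X. \<rho> x * f x)"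
  using assms
  by (auto simp: discrete_measure_def integrable_distr_eq integral_distr
      integrable_point_measure_finite lebesgue_integral_point_measure_finite)

lemma atomic_measure_iff:
  "atomic_measure r \<mu> \<longleftrightarrow>
    (\<exists>X \<rho>. finite X \<and> card X = r \<and> (\<forall>x\<in>X. 0 < \<rho> x) \<and> \<mu> = discrete_measure X \<rho>)"
proof -
  have *: "emeasure (discrete_measure X \<rho>) A = (\<Sum>x\<in>X. ennreal (\<rho> x) * emeasure (return borel x) A)"
    if "finite X" "A \<in> sets borel" for X and \<rho> :: "'a \<Rightarrow> real" and A
    using that
    by (simp add: emeasure_discrete_measure sum.inter_restrict indicator_def if_distrib cong: if_cong)
  show ?thesis
  proof
    assume "atomic_measure r \<mu>"
    then obtain X \<rho> where X: "sets \<mu> = sets borel" "finite X" "card X = r" "\<forall>x\<in>X. 0 < \<rho> x"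
      "\<forall>A\<in>sets borel. emeasure \<mu> A = (\<Sum>x\<in>X. ennreal (\<rho> x) * emeasure (return borel x) A)"
      unfolding atomic_measure_def by blast
    then have "\<mu> = discrete_measure X \<rho>" by (intro measure_eqI) (simp_all add: *)
    then show "\<exists>X \<rho>. finite X \<and> card X = r \<and> (\<forall>x\<in>X. 0 < \<rho> x) \<and> \<mu> = discrete_measure X \<rho>"
      using X by blast
  next
    assume "\<exists>X \<rho>. finite X \<and> card X = r \<and> (\<forall>x\<in>X. 0 < \<rho> x) \<and> \<mu> = discrete_measure X \<rho>"
    then obtain X \<rho> where "finite X" "card X = r" "\<forall>x\<in>X. 0 < \<rho> x" "\<mu> = discrete_measure X \<rho>"
      by blast
    then show "atomic_measure r \<mu>"
      unfolding atomic_measure_def using *[of X _ \<rho>] by (intro conjI exI[of _ X] exI[of _ \<rho>]) auto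
  qed
qed

lemma
  fixes X :: "'a::t1_space set"
  assumes X: "finite X" "\<And>x. x \<in> X \<Longrightarrow> 0 < \<rho> x"
  shows supp_discrete_measure: "supp_measure (discrete_measure X \<rho>) = X"
    and atoms_discrete_measure: "atoms (discrete_measure X \<rho>) = X"
proof -
  have pos: "0 < emeasure (discrete_measure X \<rho>) A \<longleftrightarrow> X \<inter> A \<noteq> {}" if A: "A \<in> sets borel" for A
  proof -
    have "finite (X \<inter> A)" using X by simp
    then have "(\<Sum>x\<in>X \<inter> A. ennreal (\<rho> x)) = 0 \<longleftrightarrow> (\<forall>x\<in>X \<inter> A. ennreal (\<rho> x) = 0)"
      by (rule sum_eq_0_iff)
    also have "\<dots> \<longleftrightarrow> X \<inter> A = {}" using X(2) by (force simp: ennreal_eq_0_iff)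
    finally show ?thesis using X A by (simp add: emeasure_discrete_measure zero_less_iff_neq_zero)
  qed
  show "supp_measure (discrete_measure X \<rho>) = X"
  proof
    show "X \<subseteq> supp_measure (discrete_measure X \<rho>)" by (auto simp: supp_measure_def pos)
    have "open (- X)" using X(1) by (simp add: finite_imp_closed open_Compl)
    then show "supp_measure (discrete_measure X \<rho>) \<subseteq> X"
      using pos[of "- X"] by (auto simp: supp_measure_def)
  qed
  show "atoms (discrete_measure X \<rho>) = X" by (auto simp: atoms_def pos)
qed

text \<open>Removing the null set outside \<open>X\<close> leaves a finite sum of point masses.
  Finiteness of \<open>\<nu>\<close> lets the real numbers \<open>measure \<nu> {x}\<close>
  represent them faithfully.\<close>

lemma finitely_concentrated_eq_discrete_measure:
  fixes \<nu> :: "'a::t1_space measure"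
  assumes s: "sets \<nu> = sets borel" and "finite_measure \<nu>" and X: "finite X"
    and null: "emeasure \<nu> (- X) = 0"
  shows "\<nu> = discrete_measure X (\<lambda>x. measure \<nu> {x})"
proof (rule measure_eqI)
  interpret finite_measure \<nu> by fact
  fix A assume "A \<in> sets \<nu>"
  then have A: "A \<in> sets borel" using s by simp
  have fb: "B \<in> sets \<nu>" if "finite B" for B
    using that s finite_imp_closed[of B] by (auto intro: borel_closed)
  have "- X \<in> null_sets \<nu>" using null fb[OF X] s sets.compl_sets[of X \<nu>]
    by (auto simp: null_sets_def sets_eq_imp_space_eq[OF s] Compl_eq_Diff_UNIV)
  then have "emeasure \<nu> A = emeasure \<nu> (A - (- X))"
    using A s by (intro emeasure_Diff_null_set[symmetric]) auto
  also have "A - (- X) = X \<inter> A" by auto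
  also have "emeasure \<nu> (X \<inter> A) = (\<Sum>x\<in>X \<inter> A. emeasure \<nu> {x})"
    using X fb by (intro emeasure_eq_sum_singleton) auto
  also have "\<dots> = emeasure (discrete_measure X (\<lambda>x. measure \<nu> {x})) A"
    using X A by (simp add: emeasure_discrete_measure emeasure_eq_measure)
  finally show "emeasure \<nu> A = emeasure (discrete_measure X (\<lambda>x. measure \<nu> {x})) A" .
qed (simp add: s)

text \<open>The complement is the union of all open null sets, and the Lindelof property reduces it
  to a countable union.\<close>

lemma emeasure_compl_supp_measure:
  fixes \<nu> :: "'a::second_countable_topology measure"
  assumes s: "sets \<nu> = sets borel"
  shows "emeasure \<nu> (- supp_measure \<nu>) = 0"
proof -
  let ?F = "{U. open U \<and> emeasure \<nu> U = 0}"
  obtain F' where F': "F' \<subseteq> ?F" "countable F'" "\<Union> F' = \<Union> ?F"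
    using Lindelof[of ?F] by blast
  have "(\<Union>U\<in>F'. U) \<in> null_sets \<nu>"
    using F' s by (intro null_sets_UN') (auto simp: null_sets_def)
  then have "\<Union> ?F \<in> null_sets \<nu>" using F'(3) by simp
  moreover have "- supp_measure \<nu> = \<Union> ?F"
    by (auto simp: supp_measure_def)
  ultimately show ?thesis by auto
qed

subsection \<open>Polynomial functions and representing measures\<close>

lemma borel_measurable_monom_val: "(\<lambda>t. monom_val t i) \<in> borel_measurable borel"
  unfolding monom_val_def by (intro borel_measurable_continuous_onI continuous_intros)

lemma representing_measure_cong:
  "(\<And>i. i \<in> mindices (2 * n) \<Longrightarrow> \<beta> i = \<beta>' i) \<Longrightarrow> representing_measure n \<beta> \<mu> \<longleftrightarrow> representing_measure n \<beta>' \<mu>"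
  by (auto simp: representing_measure_def)

lemma representing_measure_mono:
  "representing_measure m \<beta> \<mu> \<Longrightarrow> n \<le> m \<Longrightarrow> representing_measure n \<beta> \<mu>"
  using mindices_mono[of "2 * n" "2 * m"] by (auto simp: representing_measure_def)

lemma representing_discrete_measure_iff:
  assumes "finite X" "\<And>x. x \<in> X \<Longrightarrow> 0 \<le> \<rho> x"
  shows "representing_measure n \<beta> (discrete_measure X \<rho>) \<longleftrightarrow>
    (\<forall>i\<in>mindices (2 * n). \<beta> i = atomic_moments X \<rho> i)"
  using integral_discrete_measure[OF assms borel_measurable_monom_val]
  by (auto simp: representing_measure_def atomic_moments_def)

text \<open>The moment of index 0 is the total mass.\<close>

lemma finite_representing_measure:
  assumes "representing_measure n \<beta> \<nu>"
  shows "finite_measure \<nu>"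
proof
  have "integrable \<nu> (\<lambda>t. monom_val t 0)"
    using assms zero_in_mindices unfolding representing_measure_def by blast
  then show "emeasure \<nu> (space \<nu>) \<noteq> \<infinity>"
    by (auto simp: integrable_iff_bounded)
qed

text \<open>Polynomials are taken as functions here because they are integrated and tested for
  vanishing almost everywhere.\<close>

definition polys :: "nat \<Rightarrow> (real ^ 'n::finite \<Rightarrow> real) set" where
  "polys d = fun_space.span ((\<lambda>i t. monom_val t i) ` mindices d)"

lemma polys_monom: "i \<in> mindices d \<Longrightarrow> (\<lambda>t. monom_val t i) \<in> polys d"
  unfolding polys_def by (rule fun_space.span_base) auto

lemma polys_induct [consumes 1, case_names zero add scale monom]:
  assumes "f \<in> polys d" "P (\<lambda>t. 0)" "\<And>f g. P f \<Longrightarrow> P g \<Longrightarrow> P (\<lambda>t. f t + g t)"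
    "\<And>c f. P f \<Longrightarrow> P (\<lambda>t. c * f t)" "\<And>i. i \<in> mindices d \<Longrightarrow> P (\<lambda>t. monom_val t i)"
  shows "P f"
  using assms(1) unfolding polys_def
proof (rule fun_space.span_induct)
  show "fun_space.subspace {f. P f}"
    using assms(2-4)
    by (auto simp: fun_space.subspace_def plus_fun_def zero_fun_def fun_scale_def)
qed (use assms(5) in auto)

lemma polys_add: "f \<in> polys d \<Longrightarrow> g \<in> polys d \<Longrightarrow> (\<lambda>t. f t + g t) \<in> polys d"
  using fun_space.span_add[of f _ g] by (simp add: polys_def plus_fun_def)

lemma polys_diff: "f \<in> polys d \<Longrightarrow> g \<in> polys d \<Longrightarrow> (\<lambda>t. f t - g t) \<in> polys d"
  using fun_space.span_diff[of f _ g] by (simp add: polys_def fun_diff_def)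

lemma polys_scale: "f \<in> polys d \<Longrightarrow> (\<lambda>t. c * f t) \<in> polys d"
  using fun_space.span_scale[of f _ c] by (simp add: polys_def fun_scale_def)

lemma polys_const: "(\<lambda>t. c) \<in> polys d"
  using polys_scale[OF polys_monom[OF zero_in_mindices], of c d] by simp

lemma polys_sum: "(\<And>x. x \<in> X \<Longrightarrow> f x \<in> polys d) \<Longrightarrow> (\<lambda>t. \<Sum>x\<in>X. f x t) \<in> polys d"
proof (induction X rule: infinite_finite_induct)
  case (insert x X)
  then show ?case using polys_add[of "f x" d "\<lambda>t. \<Sum>x\<in>X. f x t"] by simp
qed (simp_all add: polys_const)

lemma polys_coordinate: "(\<lambda>t. t $ k) \<in> polys 1"
  using polys_monom[of "unit_index k" 1] by (simp add: mindices_def)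

lemma polys_mult:
  assumes "f \<in> polys a" "g \<in> polys b"
  shows "(\<lambda>t. f t * g t) \<in> polys (a + b)"
  using assms(1)
proof (induction rule: polys_induct)
  case (monom i)
  show ?case using assms(2)
  proof (induction rule: polys_induct)
    case (monom j)
    then show ?case
      using polys_monom[OF add_in_mindices[OF \<open>i \<in> mindices a\<close> monom order_refl]]
      by (simp add: monom_val_add)
  next
    case (add f g)
    then show ?case using polys_add by (fastforce simp: algebra_simps)
  next
    case (scale c f)
    then show ?case using polys_scale[OF scale, of c] by (simp add: mult_ac)
  qed (simp add: polys_const)
next
  case (add f g)
  then show ?case using polys_add by (fastforce simp: algebra_simps)
next
  case (scale c f)
  then show ?case using polys_scale[OF scale, of c] by (simp add: mult_ac)
qed (simp add: polys_const)

lemma integral_polys: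
  assumes rep: "representing_measure m (atomic_moments X \<rho>) \<nu>" and f: "f \<in> polys (2 * m)"
  shows "integrable \<nu> f \<and> (\<integral>t. f t \<partial>\<nu>) = (\<Sum>x\<in>X. \<rho> x * f x)"
  using f
proof (induction rule: polys_induct)
  case (monom i)
  then show ?case using rep by (simp add: representing_measure_def atomic_moments_def)
qed (simp_all add: sum.distrib sum_distrib_left algebra_simps)

section \<open>Truncated moment data and sums of rank-one matrices\<close>

lemma moment_rank_cong:
  assumes "\<And>i. i \<in> mindices (2 * m) \<Longrightarrow> \<beta> i = \<beta>' i"
  shows "moment_rank m \<beta> = moment_rank m \<beta>'"
proof -
  have "(\<lambda>j i. if i \<in> mindices m then \<beta> (i + j) else 0) ` mindices m =
      (\<lambda>j i. if i \<in> mindices m then \<beta>' (i + j) else 0) ` mindices m"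
    using assms add_in_mindices[of _ m _ m "2 * m"] by (intro image_cong) (auto simp: fun_eq_iff)
  then show ?thesis unfolding moment_rank_def mat_rank_def moment_matrix_def by simp
qed

lemma moment_psd_cong:
  assumes "\<And>i. i \<in> mindices (2 * m) \<Longrightarrow> \<beta> i = \<beta>' i"
  shows "moment_psd m \<beta> \<longleftrightarrow> moment_psd m \<beta>'"
proof -
  have "\<beta> (i + j) = \<beta>' (i + j)" if "i \<in> mindices m" "j \<in> mindices m" for i j
    using that assms add_in_mindices[of _ m _ m "2 * m"] by auto
  then show ?thesis by (simp add: moment_psd_def psd_def moment_matrix_def)
qed

lemma quadratic_form_rank_one_sum:
  fixes w :: "'b \<Rightarrow> real"
  assumes "\<And>i j. i \<in> I \<Longrightarrow> j \<in> I \<Longrightarrow> A i j = (\<Sum>x\<in>X. w x * f x i * f x j)"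
  shows "(\<Sum>i\<in>I. \<Sum>j\<in>I. v i * A i j * v j) = (\<Sum>x\<in>X. w x * (\<Sum>i\<in>I. v i * f x i)\<^sup>2)"
proof -
  have "(\<Sum>i\<in>I. \<Sum>j\<in>I. v i * A i j * v j) = (\<Sum>i\<in>I. \<Sum>j\<in>I. \<Sum>x\<in>X. w x * (v i * f x i) * (v j * f x j))"
    by (intro sum.cong refl) (simp add: assms sum_distrib_left sum_distrib_right mult_ac)
  also have "\<dots> = (\<Sum>i\<in>I. \<Sum>x\<in>X. \<Sum>j\<in>I. w x * (v i * f x i) * (v j * f x j))"
    by (intro sum.cong refl sum.swap)
  also have "\<dots> = (\<Sum>x\<in>X. \<Sum>i\<in>I. \<Sum>j\<in>I. w x * (v i * f x i) * (v j * f x j))"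
    by (rule sum.swap)
  also have "\<dots> = (\<Sum>x\<in>X. w x * (\<Sum>i\<in>I. v i * f x i)\<^sup>2)"
    by (simp add: power2_eq_square sum_distrib_left sum_distrib_right mult_ac)
  finally show ?thesis .
qed

lemma psd_rank_one_sum:
  fixes w :: "'b \<Rightarrow> real"
  assumes "\<And>i j. i \<in> I \<Longrightarrow> j \<in> I \<Longrightarrow> A i j = (\<Sum>x\<in>X. w x * f x i * f x j)"
    and "\<And>x. x \<in> X \<Longrightarrow> 0 \<le> w x"
  shows "psd I A"
  unfolding psd_def
proof (intro conjI ballI allI)
  show "A i j = A j i" if "i \<in> I" "j \<in> I" for i j
    using that by (simp add: assms(1) mult_ac)
  show "0 \<le> (\<Sum>i\<in>I. \<Sum>j\<in>I. v i * A i j * v j)" for v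
    using quadratic_form_rank_one_sum[of I A w f X v, OF assms(1)] assms(2) by (simp add: sum_nonneg)
qed

lemma moment_matrix_atomic_moments:
  "moment_matrix (atomic_moments X \<rho>) i j = (\<Sum>x\<in>X. \<rho> x * monom_val x i * monom_val x j)"
  by (simp add: moment_matrix_def atomic_moments_def monom_val_add mult.assoc)

lemma localizing_entry_atomic_moments:
  "localizing_entry (atomic_moments X \<rho>) q i j
    = (\<Sum>x\<in>X. (\<rho> x * poly_val q x) * monom_val x i * monom_val x j)"
proof -
  have "localizing_entry (atomic_moments X \<rho>) q i j
      = (\<Sum>a\<in>Poly_Mapping.keys q. \<Sum>x\<in>X. Poly_Mapping.lookup q a * (\<rho> x * monom_val x (a + i + j)))"
    by (simp add: localizing_entry_def atomic_moments_def sum_distrib_left)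
  also have "\<dots> = (\<Sum>x\<in>X. \<Sum>a\<in>Poly_Mapping.keys q. Poly_Mapping.lookup q a * (\<rho> x * monom_val x (a + i + j)))"
    by (rule sum.swap)
  finally show ?thesis
    by (simp add: poly_val_def monom_val_add sum_distrib_left sum_distrib_right mult_ac)
qed

subsection \<open>Atoms with interpolation polynomials\<close>

text \<open>\<open>p x\<close> is the coefficient vector of a Lagrange interpolation polynomial for
  the atom \<open>x\<close>.\<close>

locale interpolated_atoms =
  fixes n :: nat and X :: "(real ^ 'n::finite) set" and \<rho> :: "real ^ 'n \<Rightarrow> real"
    and p :: "real ^ 'n \<Rightarrow> 'n mindex \<Rightarrow> real"
  assumes finite_X: "finite X" and weight_pos: "\<And>x. x \<in> X \<Longrightarrow> 0 < \<rho> x"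
    and dual: "\<And>x y. x \<in> X \<Longrightarrow> y \<in> X \<Longrightarrow> (\<Sum>i\<in>mindices n. p x i * monom_val y i) = of_bool (x = y)"
begin

lemma mat_rank_atomic:
  assumes "n \<le> m"
    and "\<And>i j. i \<in> mindices m \<Longrightarrow> j \<in> mindices m \<Longrightarrow>
      A i j = (\<Sum>x\<in>X. w x * monom_val x i * monom_val x j)"
  shows "mat_rank (mindices m) A = card {x\<in>X. w x \<noteq> 0}"
proof (rule mat_rank_eq_card_nonzero_weights[OF finite_mindices finite_X assms(2)])
  fix x y assume xy: "x \<in> X" "y \<in> X"
  \<comment> \<open>At level \<open>m\<close> the dual vectors are the old ones padded by zeros
    above degree \<open>n\<close>.\<close>
  have "(\<Sum>i\<in>mindices m. (if i \<in> mindices n then p x i else 0) * monom_val y i)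
      = (\<Sum>i\<in>mindices n. (if i \<in> mindices n then p x i else 0) * monom_val y i)"
    using mindices_mono[OF assms(1)] finite_mindices by (intro sum.mono_neutral_right) auto
  then show "(\<Sum>i\<in>mindices m. (if i \<in> mindices n then p x i else 0) * monom_val y i) = of_bool (x = y)"
    using dual[OF xy] by simp
qed

lemma moment_rank_atomic: "n \<le> m \<Longrightarrow> moment_rank m (atomic_moments X \<rho>) = card X"
proof -
  assume "n \<le> m"
  then have "moment_rank m (atomic_moments X \<rho>) = card {x\<in>X. \<rho> x \<noteq> 0}"
    unfolding moment_rank_def by (rule mat_rank_atomic) (rule moment_matrix_atomic_moments)
  also have "{x\<in>X. \<rho> x \<noteq> 0} = X" using weight_pos by force
  finally show ?thesis .
qed

lemma moment_psd_atomic: "moment_psd m (atomic_moments X \<rho>)"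
  unfolding moment_psd_def
  by (rule psd_rank_one_sum[OF moment_matrix_atomic_moments]) (use weight_pos in force)

abbreviation interpolant :: "real ^ 'n \<Rightarrow> real ^ 'n \<Rightarrow> real" where
  "interpolant x t \<equiv> \<Sum>i\<in>mindices n. p x i * monom_val t i"

lemma interpolant_polys: "n \<le> d \<Longrightarrow> interpolant x \<in> polys d"
  using mindices_mono[of n d] by (intro polys_sum polys_scale polys_monom) auto

text \<open>\<open>X\<close> is the common zero set of the polynomials \<open>1 - \<Sum>\<^sub>x p\<^sub>x\<close> and
  \<open>(t\<^sub>k - x\<^sub>k) p\<^sub>x\<close> of degree at most \<open>n + 1\<close>, where \<open>p\<^sub>x\<close> is the interpolant at \<open>x\<close>.\<close>

theorem representing_measure_unique:
  assumes rep: "representing_measure (n + 1) (atomic_moments X \<rho>) \<nu>"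
  shows "\<nu> = discrete_measure X \<rho>"
proof -
  have s: "sets \<nu> = sets borel" using rep by (simp add: representing_measure_def)
  \<comment> \<open>The square of \<open>f\<close> has degree at most 2(n + 1), so its integral
    equals a sum over \<open>X\<close> and is zero; being nonnegative, it vanishes almost
    everywhere.\<close>
  have vanish: "AE t in \<nu>. f t = 0" if f: "f \<in> polys (n + 1)" "\<And>x. x \<in> X \<Longrightarrow> f x = 0" for f
  proof -
    have "(\<lambda>t. f t * f t) \<in> polys (2 * (n + 1))"
      using polys_mult[OF f(1) f(1)] by (simp add: mult_2)
    from integral_polys[OF rep this]
    have "integrable \<nu> (\<lambda>t. f t * f t)" "(\<integral>t. f t * f t \<partial>\<nu>) = 0" by (simp_all add: f(2))
    then show ?thesis
      using integral_nonneg_eq_0_iff_AE[of \<nu> "\<lambda>t. f t * f t"] by simp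
  qed
  have "AE t in \<nu>. 1 - (\<Sum>x\<in>X. interpolant x t) = 0"
  proof (rule vanish)
    show "(\<lambda>t. 1 - (\<Sum>x\<in>X. interpolant x t)) \<in> polys (n + 1)"
      by (intro polys_diff polys_const polys_sum[of X interpolant] interpolant_polys) simp
    show "1 - (\<Sum>x\<in>X. interpolant x y) = 0" if "y \<in> X" for y
    proof -
      have "(\<Sum>x\<in>X. interpolant x y) = (\<Sum>x\<in>X. if x = y then 1 else 0)"
        using that by (intro sum.cong) (auto simp: dual)
      then show ?thesis using that finite_X by simp
    qed
  qed
  moreover have "AE t in \<nu>. \<forall>x\<in>X. \<forall>k\<in>UNIV. (t $ k - x $ k) * interpolant x t = 0"
  proof (intro AE_finite_allI finite_X finite)
    fix x k assume x: "x \<in> X"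
    show "AE t in \<nu>. (t $ k - x $ k) * interpolant x t = 0"
    proof (rule vanish)
      show "(\<lambda>t. (t $ k - x $ k) * interpolant x t) \<in> polys (n + 1)"
        using polys_mult[OF polys_diff[OF polys_coordinate[of k] polys_const[of "x $ k"]]
            interpolant_polys[OF order_refl, of x]]
        by (simp add: add.commute)
    qed (use x in \<open>auto simp: dual\<close>)
  qed
  \<comment> \<open>At almost every \<open>t\<close> the interpolants sum to 1, so some
    \<open>interpolant x\<close> is nonzero there, which forces every \<open>t $ k - x $ k\<close>
    to be zero.\<close>
  ultimately have "AE t in \<nu>. t \<in> X"
  proof eventually_elim
    case (elim t)
    then have "(\<Sum>x\<in>X. interpolant x t) \<noteq> 0" by simp
    then obtain x where x: "x \<in> X" "interpolant x t \<noteq> 0"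
      by (rule sum.not_neutral_contains_not_neutral)
    then have "t = x" using elim(2) by (auto simp: vec_eq_iff)
    then show ?case using x by simp
  qed
  then have "emeasure \<nu> (- X) = 0"
  proof (rule AE_iff_measurable[THEN iffD1, rotated 2])
    show "- X \<in> sets \<nu>" using finite_imp_closed[OF finite_X] s by auto
    show "{t \<in> space \<nu>. t \<notin> X} = - X" using sets_eq_imp_space_eq[OF s] by auto
  qed
  then have \<nu>: "\<nu> = discrete_measure X (\<lambda>x. measure \<nu> {x})"
    by (rule finitely_concentrated_eq_discrete_measure[OF s finite_representing_measure[OF rep] finite_X])
  have "measure \<nu> {x} = \<rho> x" if x: "x \<in> X" for x
  proof -
    have pick: "(\<Sum>y\<in>X. w y * interpolant x y) = w x" for w
    proof -
      have "(\<Sum>y\<in>X. w y * interpolant x y) = (\<Sum>y\<in>X. if y = x then w y else 0)"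
        using x by (intro sum.cong) (auto simp: dual)
      then show ?thesis using x finite_X by simp
    qed
    have m: "interpolant x \<in> borel_measurable borel"
      by (intro borel_measurable_sum borel_measurable_times borel_measurable_monom_val) auto
    \<comment> \<open>The two evaluations of this integral isolate the mass of \<open>\<nu>\<close>
      at \<open>x\<close> and the weight \<open>\<rho> x\<close>.\<close>
    have "(\<integral>t. interpolant x t \<partial>\<nu>) = (\<Sum>y\<in>X. measure \<nu> {y} * interpolant x y)"
      by (rule trans[OF arg_cong[OF \<nu>, of "\<lambda>M. \<integral>t. interpolant x t \<partial>M"]
            integral_discrete_measure(2)[OF finite_X _ m]]) simp
    moreover have "(\<integral>t. interpolant x t \<partial>\<nu>) = (\<Sum>y\<in>X. \<rho> y * interpolant x y)"
      using integral_polys[OF rep interpolant_polys] by simp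
    ultimately show ?thesis by (simp only: pick)
  qed
  from trans[OF \<nu> discrete_measure_cong[OF finite_X this]] show ?thesis .
qed

section \<open>Successive flat extensions of atomic moment sequences\<close>

lemma flat_extension_atomic:
  assumes "n \<le> m" "\<And>i. i \<in> mindices (2 * m) \<Longrightarrow> atomic_moments X \<rho> i = \<beta> i"
  shows "flat_extension m \<beta> (atomic_moments X \<rho>)"
  using assms moment_rank_cong[of m "atomic_moments X \<rho>" \<beta>]
  by (simp add: flat_extension_def moment_rank_atomic)

text \<open>Induction on the level: flatness at \<open>m\<close> gives \<open>\<tau>\<close> an
  atomic representing measure up to degree 2(m + 1). It also represents the data up to degree 2(n +
  1), so uniqueness identifies it, and the new moments agree.\<close>

lemma flat_completion_unique:
  assumes agree: "\<And>i. i \<in> mindices (2 * (n + 1)) \<Longrightarrow> \<tau> i = atomic_moments X \<rho> i"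
    and flat: "\<And>m. m \<ge> n + 1 \<Longrightarrow> flat_extension m \<tau> \<tau>"
  shows "\<tau> = atomic_moments X \<rho>"
proof -
  have level: "\<forall>i\<in>mindices (2 * m). \<tau> i = atomic_moments X \<rho> i" if "m \<ge> n + 1" for m
    using that
  proof (induction m rule: dec_induct)
    case base
    show ?case using agree by simp
  next
    case (step m)
    \<comment> \<open>The induction hypothesis covers degrees up to 2m, which are exactly those in
      \<open>M(m)\<close>.\<close>
    have psd: "moment_psd m \<tau>"
      using moment_psd_cong[of m \<tau> "atomic_moments X \<rho>"] step.IH moment_psd_atomic by blast
    interpret flat_moment_matrix m \<tau>
      using psd flat[OF step.hyps(1)] by unfold_locales (simp_all add: flat_extension_def)
    obtain Y \<eta> where Y: "finite Y" "card Y = moment_rank m \<tau>" "\<And>y. y \<in> Y \<Longrightarrow> 0 < \<eta> y"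
      "\<And>i. i \<in> mindices (2 * Suc m) \<Longrightarrow> \<tau> i = atomic_moments Y \<eta> i"
      by (rule atomic_representation) (rule that)
    have "representing_measure (Suc m) \<tau> (discrete_measure Y \<eta>)"
      using Y(4) representing_discrete_measure_iff[of Y \<eta>, OF Y(1) less_imp_le[OF Y(3)]] by simp
    then have "representing_measure (n + 1) \<tau> (discrete_measure Y \<eta>)"
      by (rule representing_measure_mono) (use step.hyps in simp)
    then have "representing_measure (n + 1) (atomic_moments X \<rho>) (discrete_measure Y \<eta>)"
      using representing_measure_cong[of "n + 1" \<tau>, OF agree] by simp
    then have "discrete_measure Y \<eta> = discrete_measure X \<rho>" by (rule representing_measure_unique)
    then have "(\<integral>t. monom_val t i \<partial>discrete_measure Y \<eta>) = (\<integral>t. monom_val t i \<partial>discrete_measure X \<rho>)" for i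
      by simp
    then have "atomic_moments Y \<eta> i = atomic_moments X \<rho> i" for i
      using integral_discrete_measure(2)[OF Y(1) less_imp_le[OF Y(3)] borel_measurable_monom_val]
        integral_discrete_measure(2)[OF finite_X less_imp_le[OF weight_pos] borel_measurable_monom_val]
      by (simp add: atomic_moments_def)
    then show ?case using Y(4) by simp
  qed
  show ?thesis
  proof
    fix i :: "'n mindex"
    have "i \<in> mindices (2 * (n + 1 + mdeg i))" by (simp add: mindices_def)
    then show "\<tau> i = atomic_moments X \<rho> i" using level[of "n + 1 + mdeg i"] by simp
  qed
qed

text \<open>Atomic moments have rank \<open>card X\<close> at every level from \<open>n\<close> on,
  so they are flat throughout; with uniqueness the definite description denotes them.\<close>

lemma flat_completion_eq:
  assumes "\<And>i. i \<in> mindices (2 * (n + 1)) \<Longrightarrow> \<sigma> i = atomic_moments X \<rho> i"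
  shows "flat_completion (n + 1) \<sigma> = atomic_moments X \<rho>"
  unfolding flat_completion_def
proof (rule the_equality)
  show "(\<forall>i\<in>mindices (2 * (n + 1)). atomic_moments X \<rho> i = \<sigma> i) \<and>
    (\<forall>m\<ge>n + 1. flat_extension m (atomic_moments X \<rho>) (atomic_moments X \<rho>))"
    using assms by (auto intro: flat_extension_atomic)
  show "\<tau> = atomic_moments X \<rho>"
    if "(\<forall>i\<in>mindices (2 * (n + 1)). \<tau> i = \<sigma> i) \<and> (\<forall>m\<ge>n + 1. flat_extension m \<tau> \<tau>)" for \<tau>
    using that assms by (intro flat_completion_unique) auto
qed

section \<open>Localizing matrices of atomic moment sequences\<close>

lemma localizing_matrix_atomic:
  assumes "half_degree q = k" "i \<in> mindices n" "j \<in> mindices n"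
  shows "localizing_matrix (atomic_moments X \<rho>) q (n + k) i j
    = (\<Sum>x\<in>X. (\<rho> x * poly_val q x) * monom_val x i * monom_val x j)"
  using assms by (simp add: localizing_matrix_eq localizing_entry_atomic_moments)

text \<open>Inserting \<open>p x\<close> into the quadratic form leaves only
  \<open>\<rho> x * poly_val q x\<close>, which gives the sign of \<open>q\<close> at each
  atom.\<close>

lemma psd_localizing_matrix_iff:
  assumes "half_degree q = k"
  shows "psd (mindices n) (localizing_matrix (atomic_moments X \<rho>) q (n + k))
    \<longleftrightarrow> (\<forall>x\<in>X. 0 \<le> poly_val q x)"
proof
  assume "\<forall>x\<in>X. 0 \<le> poly_val q x"
  then show "psd (mindices n) (localizing_matrix (atomic_moments X \<rho>) q (n + k))"
    using weight_pos
    by (intro psd_rank_one_sum[OF localizing_matrix_atomic[OF assms]]) (auto simp: less_imp_le)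
next
  assume psd: "psd (mindices n) (localizing_matrix (atomic_moments X \<rho>) q (n + k))"
  show "\<forall>x\<in>X. 0 \<le> poly_val q x"
  proof
    fix x assume x: "x \<in> X"
    have "0 \<le> (\<Sum>i\<in>mindices n. \<Sum>j\<in>mindices n.
        p x i * localizing_matrix (atomic_moments X \<rho>) q (n + k) i j * p x j)"
      using psd by (simp add: psd_def)
    also have "\<dots> = (\<Sum>y\<in>X. (\<rho> y * poly_val q y) * (interpolant x y)\<^sup>2)"
      by (rule quadratic_form_rank_one_sum[OF localizing_matrix_atomic[OF assms]])
    also have "\<dots> = (\<Sum>y\<in>X. if y = x then \<rho> y * poly_val q y else 0)"
      using x by (intro sum.cong) (auto simp: dual)
    also have "\<dots> = \<rho> x * poly_val q x" using x finite_X by simp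
    finally show "0 \<le> poly_val q x" using weight_pos[OF x] by (simp add: zero_le_mult_iff)
  qed
qed

text \<open>The rank counts the nonzero weights \<open>\<rho> x * poly_val q x\<close>, that is, the
  atoms off the zero set.\<close>

lemma card_zeros_eq_rank_defect:
  assumes "half_degree q = k"
  shows "int (card (X \<inter> zero_set q))
    = int (card X) - int (mat_rank (mindices n) (localizing_matrix (atomic_moments X \<rho>) q (n + k)))"
proof -
  have "mat_rank (mindices n) (localizing_matrix (atomic_moments X \<rho>) q (n + k))
      = card {x\<in>X. \<rho> x * poly_val q x \<noteq> 0}"
    by (rule mat_rank_atomic[OF order_refl localizing_matrix_atomic[OF assms]])
  also have "{x\<in>X. \<rho> x * poly_val q x \<noteq> 0} = X - zero_set q"
    using weight_pos by (force simp: zero_set_def)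
  finally show ?thesis
    using card_Int_Diff[OF finite_X, of "zero_set q"] by simp
qed

end

text \<open>With exactly rank M(n) atoms the monomial vectors at the atoms are independent, and
  their dual vectors supply the interpolation coefficients.\<close>

lemma interpolated_atoms_exist:
  assumes "finite X" "\<And>x. x \<in> X \<Longrightarrow> 0 < \<rho> x" "card X = moment_rank n \<beta>"
    and "\<And>i. i \<in> mindices (2 * n) \<Longrightarrow> \<beta> i = atomic_moments X \<rho> i"
  shows "\<exists>p. interpolated_atoms n X \<rho> p"
proof -
  have rank: "mat_rank (mindices n) (moment_matrix (atomic_moments X \<rho>)) = card X"
    using assms(3,4) moment_rank_cong[of n \<beta>] by (simp add: moment_rank_def)
  have nonzero: "\<rho> x \<noteq> 0" if "x \<in> X" for x using assms(2)[OF that] by simp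
  obtain p where
    "\<And>x y. x \<in> X \<Longrightarrow> y \<in> X \<Longrightarrow> (\<Sum>i\<in>mindices n. p x i * monom_val y i) = of_bool (x = y)"
    by (rule dual_vectors_exist[OF finite_mindices assms(1) moment_matrix_atomic_moments _ rank],
        erule nonzero, rule that)
  then have "interpolated_atoms n X \<rho> p"
    using assms by unfold_locales auto
  then show ?thesis by blast
qed

text \<open>A representing measure of finite support is atomic on its support. This is the lower
  bound behind minimality.\<close>

lemma moment_rank_le_card_supp:
  assumes rep: "representing_measure n \<beta> \<nu>" and fin: "finite (supp_measure \<nu>)"
  shows "moment_rank n \<beta> \<le> card (supp_measure \<nu>)"
proof -
  let ?S = "supp_measure \<nu>" and ?w = "\<lambda>x. measure \<nu> {x}"
  have s: "sets \<nu> = sets borel" using rep by (simp add: representing_measure_def)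
  have "\<nu> = discrete_measure ?S ?w"
    by (rule finitely_concentrated_eq_discrete_measure[OF s finite_representing_measure[OF rep] fin
          emeasure_compl_supp_measure[OF s]])
  then have "representing_measure n \<beta> (discrete_measure ?S ?w)" using rep by simp
  then have "\<forall>i\<in>mindices (2 * n). \<beta> i = atomic_moments ?S ?w i"
    using representing_discrete_measure_iff[OF fin, of ?w] by simp
  then show ?thesis using moment_rank_le_card_atoms[OF fin] by blast
qed

text \<open>Positivity and rank at level \<open>n\<close> depend on degrees up to 2n only, so both
  pass from \<open>\<beta>\<close> to \<open>\<sigma>\<close>.\<close>

lemma atoms_of_flat_extension:
  assumes psd: "moment_psd n \<beta>" and flat: "flat_extension n \<beta> \<sigma>"
  obtains X \<rho> p where "interpolated_atoms n X \<rho> p" "card X = moment_rank n \<beta>"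
    "\<And>i. i \<in> mindices (2 * (n + 1)) \<Longrightarrow> \<sigma> i = atomic_moments X \<rho> i"
proof -
  have agree: "\<sigma> i = \<beta> i" if "i \<in> mindices (2 * n)" for i
    using flat that by (simp add: flat_extension_def)
  have rank: "moment_rank n \<sigma> = moment_rank n \<beta>" by (rule moment_rank_cong) (rule agree)
  interpret flat_moment_matrix n \<sigma>
    using psd flat moment_psd_cong[of n \<sigma> \<beta>, OF agree] rank
    by unfold_locales (simp_all add: flat_extension_def)
  obtain X \<rho> where X: "finite X" "card X = moment_rank n \<sigma>" "\<And>x. x \<in> X \<Longrightarrow> 0 < \<rho> x"
    "\<And>i. i \<in> mindices (2 * Suc n) \<Longrightarrow> \<sigma> i = atomic_moments X \<rho> i"
    by (rule atomic_representation) (rule that)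
  have "\<sigma> i = atomic_moments X \<rho> i" if "i \<in> mindices (2 * n)" for i
    using X(4) that mindices_mono[of "2 * n" "2 * Suc n"] by auto
  then obtain p where "interpolated_atoms n X \<rho> p"
    using interpolated_atoms_exist[of X \<rho> n \<sigma>, OF X(1,3,2)] by blast
  then show thesis using that[of X \<rho> p] X(2,4) rank by simp
qed

theorem theorem1p1:
  fixes \<beta> :: "'n::finite mindex \<Rightarrow> real"
    and n m :: nat
    and q :: "nat \<Rightarrow> ('n, real) mpolynomial"
    and k :: "nat \<Rightarrow> nat"
  assumes deg: "\<And>i. i \<in> {1..m} \<Longrightarrow>
      total_degree (q i) = 2 * k i \<or> int (total_degree (q i)) = 2 * int (k i) - 1"
  shows
    "((\<exists>\<mu>. representing_measure n \<beta> \<mu> \<and> atomic_measure (moment_rank n \<beta>) \<mu> \<and>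
          supp_measure \<mu> \<subseteq> basic_closed_set m q)
      \<longleftrightarrow>
      moment_psd n \<beta> \<and>
      (\<exists>\<sigma>. flat_extension n \<beta> \<sigma> \<and>
         (\<forall>i\<in>{1..m}. psd (mindices n)
            (localizing_matrix (flat_completion (n + 1) \<sigma>) (q i) (n + k i)))))
     \<and>
     (\<forall>\<sigma>. moment_psd n \<beta> \<and> flat_extension n \<beta> \<sigma> \<and>
         (\<forall>i\<in>{1..m}. psd (mindices n)
            (localizing_matrix (flat_completion (n + 1) \<sigma>) (q i) (n + k i)))
       \<longrightarrow>
       (\<exists>\<mu>. representing_measure (n + 1) \<sigma> \<mu> \<and>
          (\<forall>\<nu>. representing_measure (n + 1) \<sigma> \<nu> \<longrightarrow> \<nu> = \<mu>) \<and>
          representing_measure n \<beta> \<mu> \<and>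
          atomic_measure (moment_rank n \<beta>) \<mu> \<and>
          minimal_representing_measure n \<beta> \<mu> \<and>
          supp_measure \<mu> \<subseteq> basic_closed_set m q \<and>
          (\<forall>i\<in>{1..m}.
             int (card (atoms \<mu> \<inter> zero_set (q i))) =
             int (moment_rank n \<beta>) -
             int (mat_rank (mindices n)
               (localizing_matrix (flat_completion (n + 1) \<sigma>) (q i) (n + k i))))))"
proof -
  let ?r = "moment_rank n \<beta>"
  let ?loc = "\<lambda>\<sigma> i. localizing_matrix (flat_completion (n + 1) \<sigma>) (q i) (n + k i)"
  \<comment> \<open>In the odd case the integer equation rules out \<open>k i = 0\<close>; adding 1
    before halving covers both parities.\<close>
  have hd: "half_degree (q i) = k i" if "i \<in> {1..m}" for i
    using deg[OF that] unfolding half_degree_def by presburger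
  \<comment> \<open>This yields both the existence of the measure in the equivalence and the claims
    about every such extension.\<close>
  have flat: "\<exists>\<mu>. representing_measure (n + 1) \<sigma> \<mu> \<and>
      (\<forall>\<nu>. representing_measure (n + 1) \<sigma> \<nu> \<longrightarrow> \<nu> = \<mu>) \<and>
      representing_measure n \<beta> \<mu> \<and>
      atomic_measure ?r \<mu> \<and>
      minimal_representing_measure n \<beta> \<mu> \<and>
      supp_measure \<mu> \<subseteq> basic_closed_set m q \<and>
      (\<forall>i\<in>{1..m}. int (card (atoms \<mu> \<inter> zero_set (q i))) = int ?r - int (mat_rank (mindices n) (?loc \<sigma> i)))"
    if psd: "moment_psd n \<beta>" and ext: "flat_extension n \<beta> \<sigma>"
      and loc: "\<forall>i\<in>{1..m}. psd (mindices n) (?loc \<sigma> i)" for \<sigma>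
  proof -
    obtain X \<rho> p where "interpolated_atoms n X \<rho> p" and card: "card X = ?r"
      and mom: "\<And>i. i \<in> mindices (2 * (n + 1)) \<Longrightarrow> \<sigma> i = atomic_moments X \<rho> i"
      by (rule atoms_of_flat_extension[OF psd ext]) (rule that)
    interpret interpolated_atoms n X \<rho> p by fact
    let ?\<mu> = "discrete_measure X \<rho>"
    have compl: "flat_completion (n + 1) \<sigma> = atomic_moments X \<rho>" by (rule flat_completion_eq) (rule mom)
    have supp: "supp_measure ?\<mu> = X" and atoms: "atoms ?\<mu> = X"
      using supp_discrete_measure[of X \<rho>, OF finite_X weight_pos]
        atoms_discrete_measure[of X \<rho>, OF finite_X weight_pos] by simp_all
    have rep1: "representing_measure (n + 1) \<sigma> ?\<mu>"
      using mom representing_discrete_measure_iff[of X \<rho>, OF finite_X less_imp_le[OF weight_pos]] by blast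
    have uniq: "\<nu> = ?\<mu>" if "representing_measure (n + 1) \<sigma> \<nu>" for \<nu>
      using that representing_measure_cong[of "n + 1" \<sigma>, OF mom] representing_measure_unique by blast
    have "representing_measure n \<sigma> ?\<mu>" using rep1 by (rule representing_measure_mono) simp
    then have rep: "representing_measure n \<beta> ?\<mu>"
      using representing_measure_cong[of n \<sigma> \<beta>] ext by (simp add: flat_extension_def)
    have atomic: "atomic_measure ?r ?\<mu>"
      unfolding atomic_measure_iff using finite_X weight_pos card by blast
    have minimal: "minimal_representing_measure n \<beta> ?\<mu>"
      unfolding minimal_representing_measure_def supp card
      using rep finite_X moment_rank_le_card_supp by blast
    have "0 \<le> poly_val (q i) x" if "i \<in> {1..m}" "x \<in> X" for i x
      using loc that psd_localizing_matrix_iff[OF hd] unfolding compl by blast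
    then have K: "supp_measure ?\<mu> \<subseteq> basic_closed_set m q"
      unfolding supp basic_closed_set_def by blast
    have "int (card (atoms ?\<mu> \<inter> zero_set (q i))) = int ?r - int (mat_rank (mindices n) (?loc \<sigma> i))"
      if "i \<in> {1..m}" for i
      unfolding atoms compl card[symmetric] by (rule card_zeros_eq_rank_defect[OF hd[OF that]])
    with rep1 uniq rep atomic minimal K show ?thesis by blast
  qed
  \<comment> \<open>Conversely, the extension consists of the moments of \<open>\<mu>\<close>
    itself, a sequence defined in all degrees that is its own completion.\<close>
  have atomic: "moment_psd n \<beta> \<and> (\<exists>\<sigma>. flat_extension n \<beta> \<sigma> \<and> (\<forall>i\<in>{1..m}. psd (mindices n) (?loc \<sigma> i)))"
    if rep: "representing_measure n \<beta> \<mu>" and at: "atomic_measure ?r \<mu>"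
      and K: "supp_measure \<mu> \<subseteq> basic_closed_set m q" for \<mu>
  proof -
    obtain X \<rho> where X: "finite X" "card X = ?r" "\<And>x. x \<in> X \<Longrightarrow> 0 < \<rho> x"
      and \<mu>: "\<mu> = discrete_measure X \<rho>"
      using at unfolding atomic_measure_iff by blast
    have mom: "\<beta> i = atomic_moments X \<rho> i" if "i \<in> mindices (2 * n)" for i
      using rep that representing_discrete_measure_iff[of X \<rho>, OF X(1) less_imp_le[OF X(3)]] unfolding \<mu> by blast
    obtain p where "interpolated_atoms n X \<rho> p"
      using interpolated_atoms_exist[of X \<rho> n \<beta>, OF X(1,3,2) mom] by blast
    then interpret interpolated_atoms n X \<rho> p .
    have compl: "flat_completion (n + 1) (atomic_moments X \<rho>) = atomic_moments X \<rho>"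
      by (rule flat_completion_eq) simp
    have "moment_psd n \<beta>" using moment_psd_cong[of n \<beta>, OF mom] moment_psd_atomic by blast
    moreover have "flat_extension n \<beta> (atomic_moments X \<rho>)"
      using mom by (intro flat_extension_atomic) simp_all
    moreover have "psd (mindices n) (?loc (atomic_moments X \<rho>) i)" if i: "i \<in> {1..m}" for i
    proof -
      have "\<forall>x\<in>X. 0 \<le> poly_val (q i) x"
        using K i supp_discrete_measure[of X \<rho>, OF X(1,3)] by (auto simp: \<mu> basic_closed_set_def)
      then show ?thesis unfolding compl using psd_localizing_matrix_iff[OF hd[OF i]] by blast
    qed
    ultimately show ?thesis by blast
  qed
  show ?thesis
    using flat atomic by (intro conjI iffI; blast)
qed

end
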